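(* Let $(X_t,Y_t)$ be the position at time $t$ of the generalized alternate quantum walk started at the origin with initial coin state $\nu_0|0\rangle+\nu_1|1\rangle$, $|\nu_0|^2+|\nu_1|^2=1$, and coin $\hat{U}=\begin{pmatrix}c&s\\ s&-c\end{pmatrix}$, $c=\cos\gamma$, $s=\sin\gamma$, $\gamma\in(0,2\pi)$, $\gamma\ne\pi/2,\pi,3\pi/2$. Then \begin{equation*} \lim_{t\rightarrow\infty}P\left(\frac{X_t}{t}\le x,\frac{Y_t}{t}\le y\right)=\int_{-\infty}^x du\int_{-\infty}^y dv\,f(u,v), \end{equation*} where \begin{equation*} f(x,y)=\frac{1}{\pi^2(1-x^2)(1-y^2)}\Big\{1-(|\nu_0|^2-|\nu_1|^2)y-\frac{\nu_0\nu_1^*+\nu_0^*\nu_1}{2cs}[c^2(x-y)+s^2(x+y)]\Big\}I_D(x,y), \end{equation*} \begin{equation*} D=\left\{(x,y)\,\middle|\,\frac{(x+y)^2}{4c^2}+\frac{(x-y)^2}{4s^2}<1\right\}, \end{equation*} and $I_D(x,y)=1$ if $(x,y)\in D$, $I_D(x,y)=0$ otherwise.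
   Context: The generalized alternate quantum walk acts on $\mathcal{H}_W\otimes\mathcal{H}_C$, with walker basis $\{|x,y\rangle\}$, $x,y\in\mathbb{Z}$, and a two-level coin with basis $|0\rangle,|1\rangle$. One time step consists of: apply $\hat{U}$ to the coin, then the shift $\hat{S}_x$ (moves $x\to x-1$ if coin is $|0\rangle$, $x\to x+1$ if coin is $|1\rangle$), then apply $\hat{U}$, then the shift $\hat{S}_y$ (moves $y\to y-1$ if coin is $|0\rangle$, $y\to y+1$ if coin is $|1\rangle$). The walker starts at $(0,0)$, and $P[(X_t,Y_t)=(x,y)]$ is the probability of finding the walker at $(x,y)$ after tracing out the coin. In Fourier space the one-step operator is $\hat{V}(k_x,k_y)=\hat{R}(k_y)\hat{U}\hat{R}(k_x)\hat{U}$ with $\hat{R}(k)=\mathrm{diag}(e^{ik},e^{-ik})$. *)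

theory Defs
  imports "HOL-Analysis.Analysis"
begin

text \<open>Walker state: amplitude function on Z x Z with values in C^2 (coin components
  for |0> and |1>).\<close>
type_synonym qstate = "int \<Rightarrow> int \<Rightarrow> complex \<times> complex"

definition coinU :: "real \<Rightarrow> complex \<times> complex \<Rightarrow> complex \<times> complex" where
  "coinU \<gamma> v = (complex_of_real (cos \<gamma>) * fst v + complex_of_real (sin \<gamma>) * snd v,
                 complex_of_real (sin \<gamma>) * fst v - complex_of_real (cos \<gamma>) * snd v)"

definition apply_coin :: "real \<Rightarrow> qstate \<Rightarrow> qstate" where
  "apply_coin \<gamma> \<psi> = (\<lambda>x y. coinU \<gamma> (\<psi> x y))"

text \<open>S_x: coin |0> moves x to x-1, coin |1> moves x to x+1.\<close>
definition shift_x :: "qstate \<Rightarrow> qstate" where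
  "shift_x \<psi> = (\<lambda>x y. (fst (\<psi> (x + 1) y), snd (\<psi> (x - 1) y)))"

text \<open>S_y: coin |0> moves y to y-1, coin |1> moves y to y+1.\<close>
definition shift_y :: "qstate \<Rightarrow> qstate" where
  "shift_y \<psi> = (\<lambda>x y. (fst (\<psi> x (y + 1)), snd (\<psi> x (y - 1))))"

definition walk_step :: "real \<Rightarrow> qstate \<Rightarrow> qstate" where
  "walk_step \<gamma> \<psi> = shift_y (apply_coin \<gamma> (shift_x (apply_coin \<gamma> \<psi>)))"

definition init_state :: "complex \<Rightarrow> complex \<Rightarrow> qstate" where
  "init_state \<nu>0 \<nu>1 = (\<lambda>x y. if x = 0 \<and> y = 0 then (\<nu>0, \<nu>1) else (0, 0))"

definition walk_state :: "real \<Rightarrow> complex \<Rightarrow> complex \<Rightarrow> nat \<Rightarrow> qstate" where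
  "walk_state \<gamma> \<nu>0 \<nu>1 t = (walk_step \<gamma> ^^ t) (init_state \<nu>0 \<nu>1)"

definition walk_prob :: "real \<Rightarrow> complex \<Rightarrow> complex \<Rightarrow> nat \<Rightarrow> int \<Rightarrow> int \<Rightarrow> real" where
  "walk_prob \<gamma> \<nu>0 \<nu>1 t x y =
     (cmod (fst (walk_state \<gamma> \<nu>0 \<nu>1 t x y)))\<^sup>2 + (cmod (snd (walk_state \<gamma> \<nu>0 \<nu>1 t x y)))\<^sup>2"

text \<open>P(X_t/t \<le> x, Y_t/t \<le> y). The walker after t steps is supported in
  [-t,t] x [-t,t], so the sum ranges over that box.\<close>
definition walk_cdf :: "real \<Rightarrow> complex \<Rightarrow> complex \<Rightarrow> nat \<Rightarrow> real \<Rightarrow> real \<Rightarrow> real" where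
  "walk_cdf \<gamma> \<nu>0 \<nu>1 t x y =
     (\<Sum>p \<in> {p \<in> {- int t..int t} \<times> {- int t..int t}.
               real_of_int (fst p) / real t \<le> x \<and> real_of_int (snd p) / real t \<le> y}.
        walk_prob \<gamma> \<nu>0 \<nu>1 t (fst p) (snd p))"

definition domD :: "real \<Rightarrow> (real \<times> real) set" where
  "domD \<gamma> = {(x, y). (x + y)\<^sup>2 / (4 * (cos \<gamma>)\<^sup>2) + (x - y)\<^sup>2 / (4 * (sin \<gamma>)\<^sup>2) < 1}"

definition limit_density :: "real \<Rightarrow> complex \<Rightarrow> complex \<Rightarrow> real \<Rightarrow> real \<Rightarrow> real" where
  "limit_density \<gamma> \<nu>0 \<nu>1 x y =
     (let c = cos \<gamma>; s = sin \<gamma> in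
      1 / (pi\<^sup>2 * (1 - x\<^sup>2) * (1 - y\<^sup>2)) *
      (1 - ((cmod \<nu>0)\<^sup>2 - (cmod \<nu>1)\<^sup>2) * y
         - Re (\<nu>0 * cnj \<nu>1 + cnj \<nu>0 * \<nu>1) / (2 * c * s) * (c\<^sup>2 * (x - y) + s\<^sup>2 * (x + y)))
      * indicator (domD \<gamma>) (x, y))"

end

theory Submission
  imports Defs
begin

text \<open>
  In Fourier space the step operator lies in SU(2), so its \<open>t\<close>-th power is
  \<open>cos (t \<omega>) + i sin (t \<omega>) N\<close> with
  \<open>cos \<omega> = cos a cos b - \<kappa> sin a sin b\<close>, \<open>\<kappa> = cos (2 \<gamma>)\<close>, and an involution \<open>N\<close>.
  By Parseval the characteristic function of \<open>(X\<^sub>t, Y\<^sub>t) / t\<close> is an integral of overlaps of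
  this power at momenta differing by \<open>(\<xi>, \<eta>) / t\<close>, and dominated convergence gives its limit in
  terms of the group velocity \<open>\<nabla>\<omega>\<close> and of the expectation of \<open>N\<close> in the initial coin state.

  The relation for \<open>\<omega>\<close> is the spherical law of cosines: \<open>a, b, \<omega>\<close> are the sides of a
  triangle with fixed angle opposite to \<open>\<omega>\<close>, and the two components of \<open>\<nabla>\<omega>\<close> are the
  cosines of the other two angles. The map from sides to angles is a bijection from
  \<open>(0, \<pi>)\<^sup>2\<close> onto the ellipse \<open>D\<close> with Jacobian \<open>(1 - x\<^sup>2) (1 - y\<^sup>2)\<close>, which produces the
  density. Since all measures live on \<open>[-1, 1]\<^sup>2\<close>, Stone-Weierstrass for trigonometric
  polynomials upgrades convergence of characteristic functions to convergence of
  distribution functions.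
\<close>

section \<open>Group velocity as a spherical triangle\<close>

definition disp_cos :: "real \<Rightarrow> real \<Rightarrow> real \<Rightarrow> real" where
  "disp_cos \<kappa> a b = cos a * cos b - \<kappa> * sin a * sin b"

definition disp_sin :: "real \<Rightarrow> real \<Rightarrow> real \<Rightarrow> real" where
  "disp_sin \<kappa> a b = sqrt (1 - (disp_cos \<kappa> a b)\<^sup>2)"

text \<open>With \<omega> = arccos (\<open>disp_cos \<kappa> a b\<close>), this is the partial
  derivative of \<omega> in \<open>a\<close>, and \<open>vel_y\<close> is the one in
  \<open>b\<close>. In the spherical triangle with sides \<open>a\<close>, \<open>b\<close>,
  \<omega> whose angle opposite \<omega> has cosine -\<kappa>, they are the cosines of the angles
  opposite \<open>b\<close> and \<open>a\<close>.\<close>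

definition vel_x :: "real \<Rightarrow> real \<Rightarrow> real \<Rightarrow> real" where
  "vel_x \<kappa> a b = (sin a * cos b + \<kappa> * cos a * sin b) / disp_sin \<kappa> a b"

definition vel_y :: "real \<Rightarrow> real \<Rightarrow> real \<Rightarrow> real" where
  "vel_y \<kappa> a b = (\<kappa> * sin a * cos b + cos a * sin b) / disp_sin \<kappa> a b"

section \<open>Identities of the spherical triangle\<close>

lemma disp_cos_sq_x:
  "1 - (disp_cos \<kappa> a b)\<^sup>2 = (sin a * cos b + \<kappa> * cos a * sin b)\<^sup>2 + (1 - \<kappa>\<^sup>2) * (sin b)\<^sup>2"
proof -
  have "(sin a)\<^sup>2 = 1 - (cos a)\<^sup>2" "(sin b)\<^sup>2 = 1 - (cos b)\<^sup>2"
    by (simp_all add: sin_squared_eq)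
  then show ?thesis unfolding disp_cos_def by algebra
qed

lemma disp_cos_sq_y:
  "1 - (disp_cos \<kappa> a b)\<^sup>2 = (\<kappa> * sin a * cos b + cos a * sin b)\<^sup>2 + (1 - \<kappa>\<^sup>2) * (sin a)\<^sup>2"
proof -
  have "(sin a)\<^sup>2 = 1 - (cos a)\<^sup>2" "(sin b)\<^sup>2 = 1 - (cos b)\<^sup>2"
    by (simp_all add: sin_squared_eq)
  then show ?thesis unfolding disp_cos_def by algebra
qed

lemma one_minus_sq_pos: "\<bar>r\<bar> < 1 \<Longrightarrow> (0::real) < 1 - r\<^sup>2"
  by (simp add: abs_square_less_1)

lemma disp_cos_sq_le_one:
  assumes "\<bar>\<kappa>\<bar> < 1" shows "(disp_cos \<kappa> a b)\<^sup>2 \<le> 1"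
proof -
  have "0 \<le> 1 - (disp_cos \<kappa> a b)\<^sup>2"
    unfolding disp_cos_sq_x using one_minus_sq_pos[OF assms] by simp
  then show ?thesis by simp
qed

lemma disp_cos_sq_less_one:
  assumes "\<bar>\<kappa>\<bar> < 1" "sin a \<noteq> 0" shows "(disp_cos \<kappa> a b)\<^sup>2 < 1"
proof -
  have "0 < (1 - \<kappa>\<^sup>2) * (sin a)\<^sup>2" using one_minus_sq_pos[OF assms(1)] assms(2) by simp
  then have "0 < 1 - (disp_cos \<kappa> a b)\<^sup>2"
    unfolding disp_cos_sq_y by (simp add: add_nonneg_pos)
  then show ?thesis by simp
qed

lemma disp_sin_pos: "\<bar>\<kappa>\<bar> < 1 \<Longrightarrow> sin a \<noteq> 0 \<Longrightarrow> 0 < disp_sin \<kappa> a b"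
  unfolding disp_sin_def using disp_cos_sq_less_one[of \<kappa> a b] by simp

lemma disp_sin_sq: "\<bar>\<kappa>\<bar> < 1 \<Longrightarrow> (disp_sin \<kappa> a b)\<^sup>2 = 1 - (disp_cos \<kappa> a b)\<^sup>2"
  unfolding disp_sin_def using disp_cos_sq_le_one[of \<kappa> a b] by simp

text \<open>Law of sines: the left side is the squared sine of the angle opposite \<open>b\<close>,
  and \<open>1 - \<kappa>\<^sup>2\<close> is that of the fixed angle.\<close>

lemma one_minus_vel_x_sq:
  assumes "\<bar>\<kappa>\<bar> < 1" "sin a \<noteq> 0"
  shows "1 - (vel_x \<kappa> a b)\<^sup>2 = (1 - \<kappa>\<^sup>2) * (sin b)\<^sup>2 / (disp_sin \<kappa> a b)\<^sup>2"
proof -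
  have "0 < (disp_sin \<kappa> a b)\<^sup>2" using disp_sin_pos[OF assms, of b] by simp
  then have "1 - (vel_x \<kappa> a b)\<^sup>2 = ((disp_sin \<kappa> a b)\<^sup>2 - (sin a * cos b + \<kappa> * cos a * sin b)\<^sup>2) / (disp_sin \<kappa> a b)\<^sup>2"
    unfolding vel_x_def power_divide diff_divide_distrib by simp
  then show ?thesis unfolding disp_sin_sq[OF assms(1)] unfolding disp_cos_sq_x by simp
qed

lemma one_minus_vel_y_sq:
  assumes "\<bar>\<kappa>\<bar> < 1" "sin a \<noteq> 0"
  shows "1 - (vel_y \<kappa> a b)\<^sup>2 = (1 - \<kappa>\<^sup>2) * (sin a)\<^sup>2 / (disp_sin \<kappa> a b)\<^sup>2"
proof -
  have "0 < (disp_sin \<kappa> a b)\<^sup>2" using disp_sin_pos[OF assms, of b] by simp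
  then have "1 - (vel_y \<kappa> a b)\<^sup>2 = ((disp_sin \<kappa> a b)\<^sup>2 - (\<kappa> * sin a * cos b + cos a * sin b)\<^sup>2) / (disp_sin \<kappa> a b)\<^sup>2"
    unfolding vel_y_def power_divide diff_divide_distrib by simp
  then show ?thesis unfolding disp_sin_sq[OF assms(1)] unfolding disp_cos_sq_y by simp
qed

lemma sqrt_one_minus_vel_x_sq:
  assumes "\<bar>\<kappa>\<bar> < 1" "sin a \<noteq> 0" "0 \<le> sin b"
  shows "sqrt (1 - (vel_x \<kappa> a b)\<^sup>2) = sqrt (1 - \<kappa>\<^sup>2) * sin b / disp_sin \<kappa> a b"
  using disp_sin_pos[OF assms(1,2), of b] assms(3)
  by (simp add: one_minus_vel_x_sq[OF assms(1,2)] real_sqrt_divide real_sqrt_mult)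

text \<open>Dual law of cosines: the side \<open>a\<close> and its two adjacent angles determine the
  third angle. For fixed \<open>a\<close> it makes \<open>vel_y\<close> a function of
  \<open>vel_x\<close>; for fixed \<open>vel_x\<close> it makes \<open>vel_y\<close> affine in
  \<open>cos a\<close>.\<close>

lemma vel_y_eq:
  assumes "\<bar>\<kappa>\<bar> < 1" "sin a \<noteq> 0" "0 \<le> sin b"
  shows "vel_y \<kappa> a b = \<kappa> * vel_x \<kappa> a b + sqrt (1 - \<kappa>\<^sup>2) * sqrt (1 - (vel_x \<kappa> a b)\<^sup>2) * cos a"
proof -
  have l: "sqrt (1 - \<kappa>\<^sup>2) * sqrt (1 - \<kappa>\<^sup>2) = 1 - \<kappa>\<^sup>2" using one_minus_sq_pos[OF assms(1)] by simp
  have "sqrt (1 - \<kappa>\<^sup>2) * sqrt (1 - (vel_x \<kappa> a b)\<^sup>2) * cos a = (sqrt (1 - \<kappa>\<^sup>2) * sqrt (1 - \<kappa>\<^sup>2)) * sin b * cos a / disp_sin \<kappa> a b"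
    by (simp add: sqrt_one_minus_vel_x_sq[OF assms])
  then show ?thesis using disp_sin_pos[OF assms(1,2), of b]
    unfolding l vel_x_def vel_y_def by (simp add: field_simps power2_eq_square)
qed

text \<open>The quotient rule gives a numerator that collapses by the Pythagorean identity. For
  \<open>a\<close> and \<open>b\<close> in (0, \<pi>) the derivative is negative, so
  \<open>b\<close> can be replaced by \<open>vel_x\<close> as a coordinate.\<close>

lemma vel_x_deriv:
  assumes "\<bar>\<kappa>\<bar> < 1" "sin a \<noteq> 0"
  shows "((\<lambda>b. vel_x \<kappa> a b) has_real_derivative
           - ((1 - \<kappa>\<^sup>2) * sin a * sin b / (disp_sin \<kappa> a b)^3)) (at b)"
proof -
  let ?S = "disp_sin \<kappa> a b" and ?K = "disp_cos \<kappa> a b"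
  let ?N = "sin a * cos b + \<kappa> * cos a * sin b"
  let ?N' = "- (sin a * sin b) + \<kappa> * cos a * cos b"
  let ?K' = "- (cos a * sin b) - \<kappa> * sin a * cos b"
  have S: "0 < ?S" by (rule disp_sin_pos[OF assms])
  have K: "?K\<^sup>2 < 1" by (rule disp_cos_sq_less_one[OF assms])
  have dK: "((\<lambda>b. disp_cos \<kappa> a b) has_real_derivative ?K') (at b)"
    unfolding disp_cos_def by (auto intro!: derivative_eq_intros)
  have dS: "((\<lambda>b. disp_sin \<kappa> a b) has_real_derivative (- (?K * ?K') / ?S)) (at b)"
    unfolding disp_sin_def using K
    by (auto intro!: derivative_eq_intros dK simp: field_simps)
  have dN: "((\<lambda>b. sin a * cos b + \<kappa> * cos a * sin b) has_real_derivative ?N') (at b)"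
    by (auto intro!: derivative_eq_intros)
  have "(vel_x \<kappa> a has_real_derivative ((?N' * ?S - ?N * (- (?K * ?K') / ?S)) / (?S * ?S))) (at b)"
    unfolding vel_x_def using S by (intro DERIV_divide dN dS) auto
  moreover have "(?N' * ?S - ?N * (- (?K * ?K') / ?S)) / (?S * ?S) = (?N' * ?S\<^sup>2 + ?N * ?K * ?K') / ?S^3"
    using S by (simp add: field_simps power2_eq_square power3_eq_cube)
  moreover have "?N' * ?S\<^sup>2 + ?N * ?K * ?K' = - ((1 - \<kappa>\<^sup>2) * sin a * sin b)"
  proof -
    have "(sin a)\<^sup>2 = 1 - (cos a)\<^sup>2" "(sin b)\<^sup>2 = 1 - (cos b)\<^sup>2"
      by (simp_all add: sin_squared_eq)
    then show ?thesis unfolding disp_sin_sq[OF assms(1)] unfolding disp_cos_def by algebra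
  qed
  ultimately show ?thesis by (simp add: eta_contract_eq)
qed

section \<open>Change of variables from momenta to velocities\<close>

lemma nn_integral_substitution_antimono:
  fixes f :: "real \<Rightarrow> ennreal" and g g' :: "real \<Rightarrow> real"
  assumes [measurable]: "f \<in> borel_measurable borel"
    and derivg: "\<And>x. x \<in> {a..b} \<Longrightarrow> (g has_real_derivative - g' x) (at x)"
    and contg': "continuous_on {a..b} g'"
    and nonneg: "\<And>x. x \<in> {a..b} \<Longrightarrow> g' x \<ge> 0"
    and "a < b"
  shows "(\<integral>\<^sup>+x. f x * indicator {g b..g a} x \<partial>lborel) =
         (\<integral>\<^sup>+x. f (g x) * g' x * indicator {a..b} x \<partial>lborel)"
proof -
  \<comment> \<open>Reflecting the variable replaces the decreasing \<open>g\<close> by the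
    increasing \<open>- g\<close>.\<close>
  have "(\<integral>\<^sup>+x. f x * indicator {g b..g a} x \<partial>lborel)
      = (\<integral>\<^sup>+x. f (- x) * indicator {- g a..- g b} x \<partial>lborel)"
    by (subst nn_integral_real_affine[of _ "-1" 0])
       (auto intro!: nn_integral_cong simp: indicator_def)
  also have "\<dots> = (\<integral>\<^sup>+x. f (- (- g x)) * g' x * indicator {a..b} x \<partial>lborel)"
    using assms by (intro nn_integral_substitution_aux[where g = "\<lambda>x. - g x"])
      (auto intro!: derivative_eq_intros)
  finally show ?thesis by simp
qed

lemma continuous_disp_sin [continuous_intros]: "continuous_on A (\<lambda>b. disp_sin \<kappa> a b)"
  unfolding disp_sin_def disp_cos_def by (intro continuous_intros)

lemma vel_x_endpoints:
  assumes "\<bar>\<kappa>\<bar> < 1" "0 < sin a"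
  shows "vel_x \<kappa> a 0 = 1" "vel_x \<kappa> a pi = -1"
proof -
  have "disp_sin \<kappa> a 0 = sin a" "disp_sin \<kappa> a pi = sin a"
    using assms(2) by (simp_all add: disp_sin_def disp_cos_def cos_squared_eq)
  then show "vel_x \<kappa> a 0 = 1" "vel_x \<kappa> a pi = -1" using assms(2) by (simp_all add: vel_x_def)
qed

text \<open>The weight on the right is \<open>1 / \<bar>\<partial>x / \<partial>b\<bar>\<close> expressed in the coordinates \<open>(a, x)\<close>.\<close>

lemma nn_integral_vel_x:
  fixes G :: "real \<times> real \<Rightarrow> ennreal"
  assumes k: "\<bar>\<kappa>\<bar> < 1" and a: "0 < a" "a < pi" and [measurable]: "G \<in> borel_measurable borel"
  defines "Y \<equiv> \<lambda>u. \<kappa> * u + sqrt (1 - \<kappa>\<^sup>2) * sqrt (1 - u\<^sup>2) * cos a"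
  shows "(\<integral>\<^sup>+b. G (vel_x \<kappa> a b, vel_y \<kappa> a b) * indicator {0<..<pi} b \<partial>lborel) =
    (\<integral>\<^sup>+u. G (u, Y u) * ennreal (sqrt (1 - \<kappa>\<^sup>2) * sin a / ((1 - (Y u)\<^sup>2) * sqrt (1 - u\<^sup>2))) * indicator {-1<..<1} u \<partial>lborel)"
    (is "?L = ?R")
proof -
  let ?l = "sqrt (1 - \<kappa>\<^sup>2)"
  define W where "W u = ?l * sin a / ((1 - (Y u)\<^sup>2) * sqrt (1 - u\<^sup>2))" for u
  define g' where "g' b = (1 - \<kappa>\<^sup>2) * sin a * sin b / (disp_sin \<kappa> a b)^3" for b
  have sa: "0 < sin a" using a by (simp add: sin_gt_zero)
  have l: "0 < ?l" "?l\<^sup>2 = 1 - \<kappa>\<^sup>2" using one_minus_sq_pos[OF k] by auto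
  have S: "0 < disp_sin \<kappa> a b" for b using disp_sin_pos[OF k] sa by simp
  have [measurable]: "Y \<in> borel_measurable borel" unfolding Y_def by measurable
  have [measurable]: "W \<in> borel_measurable borel" unfolding W_def by measurable
  have AEne: "AE x in lborel. x \<noteq> (r::real)" for r by (rule AE_lborel_singleton)
  \<comment> \<open>To be read with \<open>l\<close> the sine of the fixed angle,
    \<open>p = sin a\<close>, \<open>q = sin b\<close> and \<open>d = disp_sin \<kappa> a b\<close>:
    the law of sines makes the weight \<open>W\<close> the exact reciprocal of the Jacobian
    \<open>g'\<close>.\<close>
  have alg: "l * p / ((l\<^sup>2 * p\<^sup>2 / d\<^sup>2) * (l * q / d)) * (l\<^sup>2 * p * q / d ^ 3) = 1"
    if "0 < l" "0 < p" "0 < q" "0 < d" for l p q d :: real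
    using that by (simp add: power2_eq_square power3_eq_cube)
  have W1: "ennreal (W (vel_x \<kappa> a b)) * ennreal (g' b) = 1 \<and> Y (vel_x \<kappa> a b) = vel_y \<kappa> a b"
    if "b \<in> {0<..<pi}" for b
  proof -
    have sb: "0 < sin b" using that by (simp add: sin_gt_zero)
    have Y: "Y (vel_x \<kappa> a b) = vel_y \<kappa> a b"
      unfolding Y_def using vel_y_eq[OF k, of a b] sa sb by simp
    have "W (vel_x \<kappa> a b) = ?l * sin a / ((?l\<^sup>2 * (sin a)\<^sup>2 / (disp_sin \<kappa> a b)\<^sup>2) * (?l * sin b / disp_sin \<kappa> a b))"
      unfolding W_def Y l(2)
      using one_minus_vel_y_sq[OF k, of a b] sqrt_one_minus_vel_x_sq[OF k, of a b] sa sb by simp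
    also have "\<dots> * g' b = 1"
      using alg[OF l(1) sa sb S[of b]] unfolding g'_def l(2) .
    finally have 1: "W (vel_x \<kappa> a b) * g' b = 1" .
    moreover have "0 \<le> g' b" unfolding g'_def using sa sb S[of b] one_minus_sq_pos[OF k] by simp
    ultimately show ?thesis using Y
      by (simp add: ennreal_mult''[symmetric])
  qed
  \<comment> \<open>The substitution is carried out on closed intervals. The weight is only
    meaningful inside, and the endpoints are null sets.\<close>
  have "?R = (\<integral>\<^sup>+u. (G (u, Y u) * ennreal (W u)) * indicator {vel_x \<kappa> a pi..vel_x \<kappa> a 0} u \<partial>lborel)"
    unfolding vel_x_endpoints[OF k sa] W_def
    by (intro nn_integral_cong_AE, use AEne[of 1] AEne[of "-1"] in eventually_elim)
       (auto simp: indicator_def)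
  also have "\<dots> = (\<integral>\<^sup>+b. (G (vel_x \<kappa> a b, Y (vel_x \<kappa> a b)) * ennreal (W (vel_x \<kappa> a b))) * ennreal (g' b) * indicator {0..pi} b \<partial>lborel)"
  proof (rule nn_integral_substitution_antimono)
    show "(vel_x \<kappa> a has_real_derivative - g' b) (at b)" for b
      using vel_x_deriv[OF k, of a b] sa unfolding g'_def by simp
    show "continuous_on {0..pi} g'" unfolding g'_def
      using S by (intro continuous_intros) (auto simp: less_imp_neq[symmetric] dest: less_imp_neq)
    show "0 \<le> g' b" if "b \<in> {0..pi}" for b
      unfolding g'_def using sa S[of b] that sin_ge_zero[of b] one_minus_sq_pos[OF k] by simp
  qed simp_all
  also have "\<dots> = ?L"
    by (intro nn_integral_cong_AE, use AEne[of 0] AEne[of pi] in eventually_elim)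
       (use W1 in \<open>auto simp: indicator_def mult.assoc\<close>)
  finally show ?thesis by simp
qed

text \<open>By \<open>vel_y_eq\<close>, at fixed first velocity \<open>u\<close> the second one is
  an affine function of \<open>cos a\<close>. Its Jacobian is \<open>r * sin a\<close>, and its
  range is the section of the ellipse over \<open>u\<close>.\<close>

lemma nn_integral_vel_y:
  fixes H :: "real \<Rightarrow> ennreal"
  assumes k: "\<bar>\<kappa>\<bar> < 1" and u: "\<bar>u\<bar> < 1" and [measurable]: "H \<in> borel_measurable borel"
  defines "r \<equiv> sqrt (1 - \<kappa>\<^sup>2) * sqrt (1 - u\<^sup>2)"
  shows "(\<integral>\<^sup>+a. H (\<kappa> * u + r * cos a) * ennreal (r * sin a) * indicator {0<..<pi} a \<partial>lborel) =
         (\<integral>\<^sup>+v. H v * indicator {v. \<bar>v - \<kappa> * u\<bar> < r} v \<partial>lborel)"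
proof -
  have AEne: "AE x in lborel. x \<noteq> (r::real)" for r by (rule AE_lborel_singleton)
  have r: "0 < r" unfolding r_def using one_minus_sq_pos[OF k] one_minus_sq_pos[OF u] by simp
  have "(\<integral>\<^sup>+v. H v * indicator {v. \<bar>v - \<kappa> * u\<bar> < r} v \<partial>lborel)
      = (\<integral>\<^sup>+v. H v * indicator {\<kappa> * u + r * cos pi..\<kappa> * u + r * cos 0} v \<partial>lborel)"
    by (intro nn_integral_cong_AE, use AEne[of "\<kappa> * u - r"] AEne[of "\<kappa> * u + r"] in eventually_elim)
       (auto simp: indicator_def)
  also have "\<dots> = (\<integral>\<^sup>+a. H (\<kappa> * u + r * cos a) * ennreal (r * sin a) * indicator {0..pi} a \<partial>lborel)"
    by (rule nn_integral_substitution_antimono[where g = "\<lambda>a. \<kappa> * u + r * cos a"])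
       (use r in \<open>auto intro!: derivative_eq_intros continuous_intros simp: sin_ge_zero\<close>)
  also have "\<dots> = (\<integral>\<^sup>+a. H (\<kappa> * u + r * cos a) * ennreal (r * sin a) * indicator {0<..<pi} a \<partial>lborel)"
    by (intro nn_integral_cong_AE, use AEne[of 0] AEne[of pi] in eventually_elim)
       (auto simp: indicator_def)
  finally show ?thesis by simp
qed

definition vel :: "real \<Rightarrow> real \<times> real \<Rightarrow> real \<times> real" where
  "vel \<kappa> z = (vel_x \<kappa> (fst z) (snd z), vel_y \<kappa> (fst z) (snd z))"

text \<open>This is \<open>domD \<gamma>\<close> for \<kappa> = cos (2 \<gamma>), as shown within
  \<open>limit_density_eq\<close>. The form is solved for the second coordinate, so that sections
  over the first one are visibly intervals.\<close>

definition ellipse :: "real \<Rightarrow> (real \<times> real) set" where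
  "ellipse \<kappa> = {z. (snd z - \<kappa> * fst z)\<^sup>2 < (1 - \<kappa>\<^sup>2) * (1 - (fst z)\<^sup>2)}"

text \<open>The density of the image of Lebesgue measure on the momentum square under
  \<open>vel\<close>, of total mass \<pi> squared and without the initial state.\<close>

definition base_density :: "real \<Rightarrow> real \<times> real \<Rightarrow> real" where
  "base_density \<kappa> z = indicator (ellipse \<kappa>) z / ((1 - (fst z)\<^sup>2) * (1 - (snd z)\<^sup>2))"

definition square_measure :: "(real \<times> real) measure" where
  "square_measure = restrict_space lborel ({0<..<pi} \<times> {0<..<pi})"

lemma sets_square [measurable]: "{0<..<pi} \<times> {0<..<pi} \<in> sets (borel :: (real \<times> real) measure)"
  by (intro borel_open open_Times) auto

lemma measurable_vel [measurable]: "vel \<kappa> \<in> borel_measurable borel"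
  unfolding vel_def vel_x_def vel_y_def disp_sin_def disp_cos_def borel_prod[symmetric] by measurable

lemma ellipse_sets [measurable]: "ellipse \<kappa> \<in> sets borel"
proof -
  have "{z \<in> space borel. (snd z - \<kappa> * fst z)\<^sup>2 < (1 - \<kappa>\<^sup>2) * (1 - (fst z)\<^sup>2)} \<in> sets (borel :: (real \<times> real) measure)"
    unfolding borel_prod[symmetric] by measurable
  then show ?thesis by (simp add: ellipse_def)
qed

lemma measurable_base_density [measurable]: "base_density \<kappa> \<in> borel_measurable borel"
proof -
  have [measurable]: "ellipse \<kappa> \<in> sets (borel \<Otimes>\<^sub>M borel)" unfolding borel_prod by (rule ellipse_sets)
  show ?thesis unfolding base_density_def borel_prod[symmetric] by measurable
qed

text \<open>The defining inequality is symmetric in the two coordinates, so the bound on the second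
  one follows from the same inequality with the roles exchanged.\<close>

lemma ellipse_bounds:
  assumes "\<bar>\<kappa>\<bar> < 1" "z \<in> ellipse \<kappa>"
  shows "\<bar>fst z\<bar> < 1" "\<bar>snd z\<bar> < 1"
proof -
  have k: "0 < 1 - \<kappa>\<^sup>2" by (rule one_minus_sq_pos[OF assms(1)])
  have "0 < (1 - \<kappa>\<^sup>2) * (1 - (fst z)\<^sup>2)"
    using assms(2) le_less_trans[OF zero_le_power2] by (auto simp: ellipse_def)
  then have "0 < 1 - (fst z)\<^sup>2" using k by (simp add: zero_less_mult_iff)
  then show "\<bar>fst z\<bar> < 1" by (simp add: abs_square_less_1)
  have "(fst z - \<kappa> * snd z)\<^sup>2 < (1 - \<kappa>\<^sup>2) * (1 - (snd z)\<^sup>2)"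
    using assms(2) by (simp add: ellipse_def power2_eq_square algebra_simps)
  then have "0 < (1 - \<kappa>\<^sup>2) * (1 - (snd z)\<^sup>2)"
    using le_less_trans[OF zero_le_power2] by blast
  then have "0 < 1 - (snd z)\<^sup>2" using k by (simp add: zero_less_mult_iff)
  then show "\<bar>snd z\<bar> < 1" by (simp add: abs_square_less_1)
qed

lemma base_density_nonneg: "\<bar>\<kappa>\<bar> < 1 \<Longrightarrow> 0 \<le> base_density \<kappa> z"
  using ellipse_bounds[of \<kappa> z]
  by (auto simp: base_density_def indicator_def abs_square_le_1 intro!: mult_nonneg_nonneg)

lemma ellipse_iff_abs:
  assumes "\<bar>\<kappa>\<bar> < 1" "\<bar>u\<bar> < 1"
  shows "(u, v) \<in> ellipse \<kappa> \<longleftrightarrow> \<bar>v - \<kappa> * u\<bar> < sqrt (1 - \<kappa>\<^sup>2) * sqrt (1 - u\<^sup>2)"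
proof -
  have "(u, v) \<in> ellipse \<kappa> \<longleftrightarrow> sqrt ((v - \<kappa> * u)\<^sup>2) < sqrt ((1 - \<kappa>\<^sup>2) * (1 - u\<^sup>2))"
    unfolding real_sqrt_less_iff by (simp add: ellipse_def)
  then show ?thesis by (simp add: real_sqrt_mult)
qed

text \<open>Two one-dimensional substitutions with Fubini in between: first \<open>b\<close> is
  replaced by \<open>u\<close> at fixed \<open>a\<close>, then the order is swapped, then
  \<open>a\<close> is replaced by \<open>v\<close> at fixed \<open>u\<close>. This avoids a
  two-dimensional change of variables.\<close>

lemma nn_integral_vel:
  fixes G :: "real \<times> real \<Rightarrow> ennreal"
  assumes k: "\<bar>\<kappa>\<bar> < 1" and [measurable]: "G \<in> borel_measurable borel"
  shows "(\<integral>\<^sup>+z. G (vel \<kappa> z) * indicator ({0<..<pi} \<times> {0<..<pi}) z \<partial>lborel) =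
         (\<integral>\<^sup>+z. G z * ennreal (base_density \<kappa> z) \<partial>lborel)"
proof -
  let ?l = "sqrt (1 - \<kappa>\<^sup>2)"
  define Y where "Y a u = \<kappa> * u + ?l * sqrt (1 - u\<^sup>2) * cos a" for a u
  define T where "T a u = G (u, Y a u) * ennreal (?l * sin a / ((1 - (Y a u)\<^sup>2) * sqrt (1 - u\<^sup>2)))
      * indicator {-1<..<1} u * indicator {0<..<pi} a" for a u
  have [measurable]: "(\<lambda>z. T (fst z) (snd z)) \<in> borel_measurable (lborel \<Otimes>\<^sub>M lborel)"
    unfolding T_def Y_def by measurable
  have [measurable]: "(\<lambda>z. indicator ({0<..<pi} \<times> {0<..<pi}) z :: ennreal) \<in> borel_measurable (borel :: (real \<times> real) measure)"
    by (rule borel_measurable_indicator) simp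
  have meas1: "(\<lambda>z. G (vel \<kappa> z) * indicator ({0<..<pi} \<times> {0<..<pi}) z) \<in> borel_measurable (lborel \<Otimes>\<^sub>M lborel)"
    unfolding lborel_prod by measurable
  have meas2: "(\<lambda>z. G z * ennreal (base_density \<kappa> z)) \<in> borel_measurable (lborel \<Otimes>\<^sub>M lborel)"
    unfolding lborel_prod by measurable
  have "(\<integral>\<^sup>+z. G (vel \<kappa> z) * indicator ({0<..<pi} \<times> {0<..<pi}) z \<partial>lborel) =
        (\<integral>\<^sup>+a. \<integral>\<^sup>+b. G (vel \<kappa> (a, b)) * indicator ({0<..<pi} \<times> {0<..<pi}) (a, b) \<partial>lborel \<partial>lborel)"
    unfolding lborel_prod[symmetric] by (rule lborel.nn_integral_fst[OF meas1, symmetric])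
  also have "\<dots> = (\<integral>\<^sup>+a. \<integral>\<^sup>+u. T a u \<partial>lborel \<partial>lborel)"
  proof (rule nn_integral_cong)
    fix a :: real
    show "(\<integral>\<^sup>+b. G (vel \<kappa> (a, b)) * indicator ({0<..<pi} \<times> {0<..<pi}) (a, b) \<partial>lborel) = (\<integral>\<^sup>+u. T a u \<partial>lborel)"
    proof (cases "a \<in> {0<..<pi}")
      case True
      then show ?thesis using nn_integral_vel_x[OF k, of a G]
        by (simp add: T_def Y_def vel_def indicator_times)
    qed (simp add: T_def indicator_times)
  qed
  also have "\<dots> = (\<integral>\<^sup>+u. \<integral>\<^sup>+a. T a u \<partial>lborel \<partial>lborel)"
    by (rule lborel_pair.Fubini'[symmetric]) (simp add: case_prod_unfold)
  also have "\<dots> = (\<integral>\<^sup>+u. \<integral>\<^sup>+v. G (u, v) * ennreal (base_density \<kappa> (u, v)) \<partial>lborel \<partial>lborel)"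
  proof (rule nn_integral_cong)
    fix u :: real
    show "(\<integral>\<^sup>+a. T a u \<partial>lborel) = (\<integral>\<^sup>+v. G (u, v) * ennreal (base_density \<kappa> (u, v)) \<partial>lborel)"
    proof (cases "\<bar>u\<bar> < 1")
      case True
      define H where "H v = G (u, v) * ennreal (1 / ((1 - u\<^sup>2) * (1 - v\<^sup>2)))" for v
      have [measurable]: "H \<in> borel_measurable borel" unfolding H_def by measurable
      have u: "0 < 1 - u\<^sup>2" by (rule one_minus_sq_pos[OF True])
      have "T a u = H (\<kappa> * u + ?l * sqrt (1 - u\<^sup>2) * cos a) * ennreal (?l * sqrt (1 - u\<^sup>2) * sin a) * indicator {0<..<pi} a" for a
      proof (cases "a \<in> {0<..<pi}")
        case a: True
        define q where "q = sqrt (1 - u\<^sup>2)"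
        have q: "0 < q" "1 - u\<^sup>2 = q * q" using u by (auto simp: q_def)
        \<comment> \<open>The weight of the first substitution splits into the Jacobian of the
          second one and a remainder, and the remainder is \<open>base_density\<close> on the
          ellipse.\<close>
        have "?l * sin a / ((1 - (Y a u)\<^sup>2) * q) = 1 / ((q * q) * (1 - (Y a u)\<^sup>2)) * (?l * q * sin a)"
          using q(1) by simp
        moreover have "0 \<le> ?l * q * sin a"
          using a q one_minus_sq_pos[OF k] by (auto intro!: mult_nonneg_nonneg sin_ge_zero)
        ultimately have "ennreal (?l * sin a / ((1 - (Y a u)\<^sup>2) * q)) = ennreal (1 / ((1 - u\<^sup>2) * (1 - (Y a u)\<^sup>2))) * ennreal (?l * q * sin a)"
          unfolding q(2) by (simp only: ennreal_mult''[symmetric])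
        moreover have "u \<in> {-1<..<1}" using True by auto
        ultimately show ?thesis using a unfolding Y_def[symmetric]
          by (simp add: T_def H_def mult.assoc q_def)
      qed (simp add: T_def)
      then have "(\<integral>\<^sup>+a. T a u \<partial>lborel) = (\<integral>\<^sup>+v. H v * indicator {v. \<bar>v - \<kappa> * u\<bar> < ?l * sqrt (1 - u\<^sup>2)} v \<partial>lborel)"
        using nn_integral_vel_y[OF k True, of H] by simp
      also have "\<dots> = (\<integral>\<^sup>+v. G (u, v) * ennreal (base_density \<kappa> (u, v)) \<partial>lborel)"
        by (intro nn_integral_cong) (simp add: H_def base_density_def ellipse_iff_abs[OF k True] indicator_def)
      finally show ?thesis .
    next
      case False
      then have "(u, v) \<notin> ellipse \<kappa>" for v using ellipse_bounds(1)[OF k, of "(u, v)"] by auto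
      then have "base_density \<kappa> (u, v) = 0" for v by (simp add: base_density_def)
      moreover have "T a u = 0" for a using False by (auto simp: T_def indicator_def)
      ultimately show ?thesis by simp
    qed
  qed
  also have "\<dots> = (\<integral>\<^sup>+z. G z * ennreal (base_density \<kappa> z) \<partial>lborel)"
    unfolding lborel_prod[symmetric] by (rule lborel.nn_integral_fst[OF meas2])
  finally show ?thesis .
qed

section \<open>Integration over the momentum square\<close>

lemma space_square_measure [simp]: "space square_measure = {0<..<pi} \<times> {0<..<pi}"
  by (simp add: square_measure_def space_restrict_space)

lemma measurable_square_measure:
  "f \<in> borel_measurable borel \<Longrightarrow> f \<in> borel_measurable square_measure"
  unfolding square_measure_def by (intro measurable_restrict_space1) simp

lemma nn_integral_square_measure:
  "(\<integral>\<^sup>+z. f z \<partial>square_measure) = (\<integral>\<^sup>+z. f z * indicator ({0<..<pi} \<times> {0<..<pi}) z \<partial>lborel)"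
  unfolding square_measure_def by (intro nn_integral_restrict_space) simp

lemma integral_square_measure:
  fixes f :: "real \<times> real \<Rightarrow> 'a::{banach, second_countable_topology}"
  shows "(\<integral>z. f z \<partial>square_measure) = (\<integral>z. indicator ({0<..<pi} \<times> {0<..<pi}) z *\<^sub>R f z \<partial>lborel)"
  unfolding square_measure_def by (intro integral_restrict_space) simp

lemma finite_square_measure: "finite_measure square_measure"
proof
  have "emeasure square_measure (space square_measure)
      = emeasure lborel ({0<..<pi} \<times> {0<..<pi} :: (real \<times> real) set)"
    unfolding space_square_measure unfolding square_measure_def
    by (subst emeasure_restrict_space) auto
  also have "\<dots> = emeasure lborel {0<..<pi} * emeasure lborel {0<..<pi}"
    unfolding lborel_prod[symmetric] by (intro lborel.emeasure_pair_measure_Times) auto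
  finally show "emeasure square_measure (space square_measure) \<noteq> \<infinity>"
    by (simp add: ennreal_mult_eq_top_iff)
qed

text \<open>Applied to indicators, \<open>nn_integral_vel\<close> identifies the image measure of
  the square under \<open>vel\<close>. Values and integrability of vector-valued integrals then
  transfer together.\<close>

lemma integral_vel:
  fixes F :: "real \<times> real \<Rightarrow> 'a::{banach, second_countable_topology}"
  assumes k: "\<bar>\<kappa>\<bar> < 1" and [measurable]: "F \<in> borel_measurable borel"
  shows "(\<integral>z. F (vel \<kappa> z) \<partial>square_measure) = (\<integral>z. base_density \<kappa> z *\<^sub>R F z \<partial>lborel)"
    and "integrable square_measure (\<lambda>z. F (vel \<kappa> z)) \<longleftrightarrow> integrable lborel (\<lambda>z. base_density \<kappa> z *\<^sub>R F z)"
proof -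
  have m: "vel \<kappa> \<in> measurable square_measure borel"
    by (intro measurable_square_measure) simp
  have eq: "distr square_measure borel (vel \<kappa>) = density lborel (\<lambda>z. ennreal (base_density \<kappa> z))"
  proof (rule measure_eqI)
    fix A assume "A \<in> sets (distr square_measure borel (vel \<kappa>))"
    then have A [measurable]: "A \<in> sets borel" by simp
    have "emeasure (distr square_measure borel (vel \<kappa>)) A = (\<integral>\<^sup>+z. indicator A (vel \<kappa> z) \<partial>square_measure)"
      using nn_integral_distr[OF m, of "indicator A"] by simp
    also have "\<dots> = (\<integral>\<^sup>+z. indicator A z * ennreal (base_density \<kappa> z) \<partial>lborel)"
      unfolding nn_integral_square_measure by (rule nn_integral_vel[OF k]) simp
    also have "\<dots> = emeasure (density lborel (\<lambda>z. ennreal (base_density \<kappa> z))) A"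
      by (simp add: emeasure_density mult.commute)
    finally show "emeasure (distr square_measure borel (vel \<kappa>)) A
        = emeasure (density lborel (\<lambda>z. ennreal (base_density \<kappa> z))) A" .
  qed simp
  show "(\<integral>z. F (vel \<kappa> z) \<partial>square_measure) = (\<integral>z. base_density \<kappa> z *\<^sub>R F z \<partial>lborel)"
    using integral_distr[OF m, of F]
    unfolding eq by (simp add: integral_density base_density_nonneg[OF k])
  show "integrable square_measure (\<lambda>z. F (vel \<kappa> z)) \<longleftrightarrow> integrable lborel (\<lambda>z. base_density \<kappa> z *\<^sub>R F z)"
    using integrable_distr_eq[OF m, of F]
    unfolding eq by (simp add: integrable_density base_density_nonneg[OF k])
qed

section \<open>Point reflection of the momentum square\<close>

lemma integral_square_reflect:
  fixes F :: "real \<times> real \<Rightarrow> 'a::{banach, second_countable_topology}"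
  assumes [measurable]: "F \<in> borel_measurable borel"
  shows "(\<integral>z. F ((pi, pi) - z) \<partial>square_measure) = (\<integral>z. F z \<partial>square_measure)"
proof -
  let ?G = "\<lambda>z. indicator ({0<..<pi} \<times> {0<..<pi}) z *\<^sub>R F z"
  have "(\<integral>z. ?G z \<partial>lborel) = (\<integral>z. ?G z \<partial>distr lborel borel (\<lambda>z. (pi, pi) + (-1) *\<^sub>R z))"
    using lborel_affine[of "-1" "(pi, pi)"] by (simp add: density_1)
  also have "\<dots> = (\<integral>z. ?G ((pi, pi) + (-1) *\<^sub>R z) \<partial>lborel)"
    by (intro integral_distr) auto
  also have "\<dots> = (\<integral>z. indicator ({0<..<pi} \<times> {0<..<pi}) z *\<^sub>R F ((pi, pi) - z) \<partial>lborel)"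
    by (intro Bochner_Integration.integral_cong) (auto simp: indicator_def)
  finally show ?thesis unfolding integral_square_measure by simp
qed

text \<open>The reflection preserves Lebesgue measure, so the integral equals its own negative. This
  discards the parts of the limiting overlap that do not reach the density.\<close>

lemma integral_square_odd:
  fixes F :: "real \<times> real \<Rightarrow> 'a::{banach, second_countable_topology}"
  assumes [measurable]: "F \<in> borel_measurable borel"
    and odd: "\<And>z. F ((pi, pi) - z) = - F z"
  shows "(\<integral>z. F z \<partial>square_measure) = 0"
proof -
  have "(\<integral>z. F z \<partial>square_measure) = - (\<integral>z. F z \<partial>square_measure)"
    using integral_square_reflect[of F] by (simp add: odd)
  then have "2 *\<^sub>R (\<integral>z. F z \<partial>square_measure) = 0"
    by (metis add.right_inverse scaleR_2)
  then show ?thesis by simp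
qed

section \<open>The walk in Fourier space\<close>

definition site_box :: "nat \<Rightarrow> (int \<times> int) set" where
  "site_box t = {- int t..int t} \<times> {- int t..int t}"

definition amp0 :: "real \<Rightarrow> complex \<Rightarrow> complex \<Rightarrow> nat \<Rightarrow> int \<times> int \<Rightarrow> complex" where
  "amp0 \<gamma> \<nu>0 \<nu>1 t p = fst (walk_state \<gamma> \<nu>0 \<nu>1 t (fst p) (snd p))"

definition amp1 :: "real \<Rightarrow> complex \<Rightarrow> complex \<Rightarrow> nat \<Rightarrow> int \<times> int \<Rightarrow> complex" where
  "amp1 \<gamma> \<nu>0 \<nu>1 t p = snd (walk_state \<gamma> \<nu>0 \<nu>1 t (fst p) (snd p))"

text \<open>With the minus sign in the exponent, the move of coin state 0 by -1 becomes
  multiplication by \<open>cis\<close> of the momentum, in agreement with the operators R of the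
  Fourier picture.\<close>

definition fourier :: "nat \<Rightarrow> (int \<times> int \<Rightarrow> complex) \<Rightarrow> real \<Rightarrow> real \<Rightarrow> complex" where
  "fourier t f a b = (\<Sum>p\<in>site_box t. f p * cis (- (a * fst p + b * snd p)))"

lemma finite_site_box [simp]: "finite (site_box t)" by (simp add: site_box_def)

lemma amp_0:
  "amp0 \<gamma> \<nu>0 \<nu>1 0 p = (if p = 0 then \<nu>0 else 0)" "amp1 \<gamma> \<nu>0 \<nu>1 0 p = (if p = 0 then \<nu>1 else 0)"
  by (auto simp: amp0_def amp1_def walk_state_def init_state_def prod_eq_iff)

lemma amp_Suc:
  fixes \<gamma> \<nu>0 \<nu>1
  defines "c \<equiv> complex_of_real (cos \<gamma>)" and "s \<equiv> complex_of_real (sin \<gamma>)"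
    and "f \<equiv> amp0 \<gamma> \<nu>0 \<nu>1" and "g \<equiv> amp1 \<gamma> \<nu>0 \<nu>1"
  shows "f (Suc t) p = c\<^sup>2 * f t (p + (1, 1)) + c * s * g t (p + (1, 1))
            + s\<^sup>2 * f t (p + (-1, 1)) - c * s * g t (p + (-1, 1))"
    and "g (Suc t) p = c * s * f t (p + (1, -1)) + s\<^sup>2 * g t (p + (1, -1))
            - c * s * f t (p + (-1, -1)) + c\<^sup>2 * g t (p + (-1, -1))"
  unfolding assms
  by (simp_all add: amp0_def amp1_def walk_state_def walk_step_def shift_x_def shift_y_def
      apply_coin_def coinU_def algebra_simps power2_eq_square)

text \<open>After \<open>t\<close> steps both coordinates are congruent to \<open>t\<close> modulo 2. Hence only even
  frequencies occur in the Parseval identity, and these are already orthogonal on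
  \<open>(0, \<pi>)\<^sup>2\<close>, where the group velocity is smooth.\<close>

definition parity_supp :: "nat \<Rightarrow> (int \<times> int \<Rightarrow> complex) \<Rightarrow> bool" where
  "parity_supp t f \<longleftrightarrow> (\<forall>p. f p \<noteq> 0 \<longrightarrow> p \<in> site_box t \<and> even (fst p + int t) \<and> even (snd p + int t))"

text \<open>Every term of the recursion is displaced by 1 or -1 in both coordinates, so each step
  flips both parities and widens the box by one. The two components are coupled and need a joint
  induction.\<close>

lemma parity_supp_amp:
  "parity_supp t (amp0 \<gamma> \<nu>0 \<nu>1 t)" "parity_supp t (amp1 \<gamma> \<nu>0 \<nu>1 t)"
proof (induction t)
  case 0
  show "parity_supp 0 (amp0 \<gamma> \<nu>0 \<nu>1 0)" "parity_supp 0 (amp1 \<gamma> \<nu>0 \<nu>1 0)"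
    by (auto simp: parity_supp_def amp_0 site_box_def zero_prod_def split: if_splits)
next
  case (Suc t)
  let ?Q = "\<lambda>p. amp0 \<gamma> \<nu>0 \<nu>1 t p \<noteq> 0 \<or> amp1 \<gamma> \<nu>0 \<nu>1 t p \<noteq> 0"
  have Q: "p \<in> site_box t \<and> even (fst p + int t) \<and> even (snd p + int t)" if "?Q p" for p
    using Suc that unfolding parity_supp_def by blast
  have step: "p \<in> site_box (Suc t) \<and> even (fst p + int (Suc t)) \<and> even (snd p + int (Suc t))"
    if "?Q (p + d)" "d \<in> {-1, 1} \<times> {-1, 1}" for p d
    using Q[OF that(1)] that(2) by (cases p) (auto simp: site_box_def)
  show "parity_supp (Suc t) (amp0 \<gamma> \<nu>0 \<nu>1 (Suc t))"
    unfolding parity_supp_def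
  proof (intro allI impI)
    fix p assume "amp0 \<gamma> \<nu>0 \<nu>1 (Suc t) p \<noteq> 0"
    then have "?Q (p + (1, 1)) \<or> ?Q (p + (-1, 1))" unfolding amp_Suc by auto
    then show "p \<in> site_box (Suc t) \<and> even (fst p + int (Suc t)) \<and> even (snd p + int (Suc t))"
      using step[of p "(1, 1)"] step[of p "(-1, 1)"] by blast
  qed
  show "parity_supp (Suc t) (amp1 \<gamma> \<nu>0 \<nu>1 (Suc t))"
    unfolding parity_supp_def
  proof (intro allI impI)
    fix p assume "amp1 \<gamma> \<nu>0 \<nu>1 (Suc t) p \<noteq> 0"
    then have "?Q (p + (1, -1)) \<or> ?Q (p + (-1, -1))" unfolding amp_Suc by auto
    then show "p \<in> site_box (Suc t) \<and> even (fst p + int (Suc t)) \<and> even (snd p + int (Suc t))"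
      using step[of p "(1, -1)"] step[of p "(-1, -1)"] by blast
  qed
qed

text \<open>A translation becomes a phase after reindexing. The boxes for \<open>t\<close> and
  \<open>Suc t\<close> do not match under the translation, but all terms outside the support of
  \<open>f\<close> vanish.\<close>

lemma fourier_shift:
  assumes "parity_supp t f" "d \<in> {-1, 1} \<times> {-1, 1}"
  shows "fourier (Suc t) (\<lambda>p. f (p + d)) a b = cis (a * fst d + b * snd d) * fourier t f a b"
proof -
  have supp: "p \<in> site_box t" if "f p \<noteq> 0" for p using assms(1) that unfolding parity_supp_def by blast
  have "fourier (Suc t) (\<lambda>p. f (p + d)) a b
      = (\<Sum>p\<in>site_box t. f p * cis (- (a * fst (p - d) + b * snd (p - d))))"
    unfolding fourier_def
  proof (rule sum.reindex_bij_witness_not_neutral[where i = "\<lambda>p. p - d" and j = "\<lambda>p. p + d"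
        and S' = "{p \<in> site_box (Suc t). f (p + d) = 0}" and T' = "{p \<in> site_box t. f p = 0}"])
    fix p assume "p \<in> site_box t - {p \<in> site_box t. f p = 0}"
    then show "p - d \<in> site_box (Suc t) - {p \<in> site_box (Suc t). f (p + d) = 0}"
      using assms(2) by (auto simp: site_box_def)
  qed (auto intro: supp)
  also have "\<dots> = cis (a * fst d + b * snd d) * fourier t f a b"
    unfolding fourier_def sum_distrib_left
  proof (rule sum.cong[OF refl])
    fix p :: "int \<times> int"
    have "- (a * fst (p - d) + b * snd (p - d)) = (a * fst d + b * snd d) + - (a * fst p + b * snd p)"
      by (simp add: algebra_simps)
    then show "f p * cis (- (a * fst (p - d) + b * snd (p - d))) =
        cis (a * fst d + b * snd d) * (f p * cis (- (a * fst p + b * snd p)))"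
      by (simp only: cis_mult[symmetric] mult_ac)
  qed
  finally show ?thesis .
qed

lemma fourier_linear:
  "fourier t (\<lambda>p. f p + g p) a b = fourier t f a b + fourier t g a b"
  "fourier t (\<lambda>p. f p - g p) a b = fourier t f a b - fourier t g a b"
  "fourier t (\<lambda>p. k * f p) a b = k * fourier t f a b"
  by (simp_all add: fourier_def sum.distrib sum_subtractf sum_distrib_left algebra_simps)

text \<open>The Hermitian involution of the closed form has diagonal \<open>\<plusminus> vel_y\<close> and upper right entry \<open>axis_w\<close>.\<close>

definition axis_w :: "real \<Rightarrow> real \<Rightarrow> real \<Rightarrow> complex" where
  "axis_w \<gamma> a b = of_real (sin (2 * \<gamma>) * sin a / disp_sin (cos (2 * \<gamma>)) a b) * cis b"

text \<open>The step operator is \<open>disp_cos + \<i> M\<close> with \<open>M\<close> Hermitian and traceless, with entries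
  \<open>rot_z\<close> and \<open>rot_w\<close>.\<close>

abbreviation (input) rot_z :: "real \<Rightarrow> real \<Rightarrow> real \<Rightarrow> real" where
  "rot_z \<gamma> a b \<equiv> cos (2 * \<gamma>) * sin a * cos b + cos a * sin b"

abbreviation (input) rot_w :: "real \<Rightarrow> real \<Rightarrow> real \<Rightarrow> complex" where
  "rot_w \<gamma> a b \<equiv> complex_of_real (sin (2 * \<gamma>) * sin a) * cis b"

section \<open>Closed form of the Fourier amplitudes\<close>

context
  fixes \<gamma> :: real and \<nu>0 \<nu>1 :: complex
begin

definition "famp0 t a b = fourier t (amp0 \<gamma> \<nu>0 \<nu>1 t) a b"
definition "famp1 t a b = fourier t (amp1 \<gamma> \<nu>0 \<nu>1 t) a b"

lemma famp_0: "famp0 0 a b = \<nu>0" "famp1 0 a b = \<nu>1"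
proof -
  have "site_box 0 = {0}" by (auto simp: site_box_def zero_prod_def)
  then show "famp0 0 a b = \<nu>0" "famp1 0 a b = \<nu>1"
    by (simp_all add: famp0_def famp1_def fourier_def amp_0)
qed

text \<open>The four translations of \<open>amp_Suc\<close> assemble into the matrix R(b) U R(a) U.
  It lies in SU(2), since U has determinant -1 and enters twice.\<close>

lemma famp_Suc:
  "famp0 (Suc t) a b = Complex (disp_cos (cos (2 * \<gamma>)) a b) (rot_z \<gamma> a b) * famp0 t a b + \<i> * rot_w \<gamma> a b * famp1 t a b"
  "famp1 (Suc t) a b = \<i> * cnj (rot_w \<gamma> a b) * famp0 t a b + Complex (disp_cos (cos (2 * \<gamma>)) a b) (- rot_z \<gamma> a b) * famp1 t a b"
proof -
  let ?c = "complex_of_real (cos \<gamma>)" and ?s = "complex_of_real (sin \<gamma>)"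
  note supp = parity_supp_amp[of t \<gamma> \<nu>0 \<nu>1]
  have k: "cos (2 * \<gamma>) = (cos \<gamma>)\<^sup>2 - (sin \<gamma>)\<^sup>2" "1 = (cos \<gamma>)\<^sup>2 + (sin \<gamma>)\<^sup>2" "sin (2 * \<gamma>) = 2 * sin \<gamma> * cos \<gamma>"
    by (simp_all add: cos_double sin_double)
  have V00: "?c\<^sup>2 * cis (a + b) + ?s\<^sup>2 * cis (b - a) = Complex (disp_cos (cos (2 * \<gamma>)) a b) (rot_z \<gamma> a b)"
  proof -
    have "(cos \<gamma>)\<^sup>2 * cos (a + b) + (sin \<gamma>)\<^sup>2 * cos (b - a) = disp_cos (cos (2 * \<gamma>)) a b"
      unfolding disp_cos_def k(1) using k(2) unfolding cos_add cos_diff by algebra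
    moreover have "(cos \<gamma>)\<^sup>2 * sin (a + b) + (sin \<gamma>)\<^sup>2 * sin (b - a) = rot_z \<gamma> a b"
      unfolding k(1) using k(2) unfolding sin_add sin_diff by algebra
    ultimately show ?thesis by (simp add: complex_eq_iff flip: of_real_power)
  qed
  \<comment> \<open>In SU(2) the second diagonal entry is the conjugate of the first.\<close>
  have V11: "?s\<^sup>2 * cis (a - b) + ?c\<^sup>2 * cis (- a - b) = Complex (disp_cos (cos (2 * \<gamma>)) a b) (- rot_z \<gamma> a b)"
  proof -
    have "?s\<^sup>2 * cis (a - b) + ?c\<^sup>2 * cis (- a - b) = cnj (?c\<^sup>2 * cis (a + b) + ?s\<^sup>2 * cis (b - a))"
      by (simp add: cis_cnj)
    then show ?thesis unfolding V00 by (simp add: complex_eq_iff)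
  qed
  have V01: "?c * ?s * (cis (a + b) - cis (b - a)) = \<i> * rot_w \<gamma> a b"
    unfolding k(3) by (simp add: complex_eq_iff cos_add cos_diff sin_add sin_diff algebra_simps)
  have V10: "?c * ?s * (cis (a - b) - cis (- a - b)) = \<i> * cnj (rot_w \<gamma> a b)"
    unfolding k(3) by (simp add: complex_eq_iff cos_add cos_diff sin_add sin_diff algebra_simps)
  note sh = fourier_shift[OF supp(1)] fourier_shift[OF supp(2)]
  have "famp0 (Suc t) a b = (?c\<^sup>2 * cis (a + b) + ?s\<^sup>2 * cis (b - a)) * famp0 t a b
      + ?c * ?s * (cis (a + b) - cis (b - a)) * famp1 t a b"
    unfolding famp0_def famp1_def amp_Suc[abs_def] by (simp add: fourier_linear sh algebra_simps)
  then show "famp0 (Suc t) a b = Complex (disp_cos (cos (2 * \<gamma>)) a b) (rot_z \<gamma> a b) * famp0 t a b + \<i> * rot_w \<gamma> a b * famp1 t a b"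
    unfolding V00 V01 .
  have "famp1 (Suc t) a b = ?c * ?s * (cis (a - b) - cis (- a - b)) * famp0 t a b
      + (?s\<^sup>2 * cis (a - b) + ?c\<^sup>2 * cis (- a - b)) * famp1 t a b"
    unfolding famp0_def famp1_def amp_Suc[abs_def] by (simp add: fourier_linear sh algebra_simps)
  then show "famp1 (Suc t) a b = \<i> * cnj (rot_w \<gamma> a b) * famp0 t a b + Complex (disp_cos (cos (2 * \<gamma>)) a b) (- rot_z \<gamma> a b) * famp1 t a b"
    unfolding V11 V10 .
qed

text \<open>Unitarity of the step at each single momentum: the cross terms cancel, and the squares
  of \<open>disp_cos\<close>, \<open>rot_z\<close> and the modulus of \<open>rot_w\<close> add up to
  1. It supplies the domination for the limit.\<close>

lemma famp_norm: "(cmod (famp0 t a b))\<^sup>2 + (cmod (famp1 t a b))\<^sup>2 = (cmod \<nu>0)\<^sup>2 + (cmod \<nu>1)\<^sup>2"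
proof (induction t)
  case 0
  show ?case by (simp add: famp_0)
next
  case (Suc t)
  have unitary: "(cmod (Complex K z * F + \<i> * w * G))\<^sup>2 + (cmod (\<i> * cnj w * F + Complex K (- z) * G))\<^sup>2
      = (K\<^sup>2 + z\<^sup>2 + (cmod w)\<^sup>2) * ((cmod F)\<^sup>2 + (cmod G)\<^sup>2)" for K z :: real and w F G :: complex
    unfolding cmod_power2 by (simp add: power2_eq_square algebra_simps)
  have "(cmod (rot_w \<gamma> a b))\<^sup>2 = (sin (2 * \<gamma>))\<^sup>2 * (sin a)\<^sup>2"
    by (simp add: norm_mult power_mult_distrib)
  then have "(disp_cos (cos (2 * \<gamma>)) a b)\<^sup>2 + (rot_z \<gamma> a b)\<^sup>2 + (cmod (rot_w \<gamma> a b))\<^sup>2 = 1"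
    using disp_cos_sq_y[of "cos (2 * \<gamma>)" a b] by (simp add: sin_squared_eq)
  then show ?case unfolding famp_Suc unitary by (simp add: Suc)
qed

text \<open>The law of sines again. It says that the Hermitian matrix with rows
  (\<open>vel_y\<close>, \<open>axis_w\<close>) and (\<open>cnj axis_w\<close>,
  \<open>- vel_y\<close>) squares to the identity.\<close>

lemma axis_norm:
  assumes "\<bar>cos (2 * \<gamma>)\<bar> < 1" "sin a \<noteq> 0"
  shows "(vel_y (cos (2 * \<gamma>)) a b)\<^sup>2 + (cmod (axis_w \<gamma> a b))\<^sup>2 = 1"
  using one_minus_vel_y_sq[OF assms, of b]
  by (simp add: axis_w_def norm_mult power_mult_distrib sin_squared_eq power_divide norm_divide)

text \<open>The step is cos \<omega> + \<i> sin \<omega> N with N squaring to the identity, so its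
  powers follow the addition theorems, as in de Moivre's formula. The induction uses only this
  relation and that \<i> squares to -1.\<close>

lemma famp_closed:
  fixes a b :: real
  assumes "\<bar>cos (2 * \<gamma>)\<bar> < 1" "sin a \<noteq> 0"
  defines "\<omega> \<equiv> arccos (disp_cos (cos (2 * \<gamma>)) a b)" and "z \<equiv> complex_of_real (vel_y (cos (2 * \<gamma>)) a b)" and "w \<equiv> axis_w \<gamma> a b"
  shows "famp0 t a b = of_real (cos (real t * \<omega>)) * \<nu>0 + \<i> * of_real (sin (real t * \<omega>)) * (z * \<nu>0 + w * \<nu>1)"
    and "famp1 t a b = of_real (cos (real t * \<omega>)) * \<nu>1 + \<i> * of_real (sin (real t * \<omega>)) * (cnj w * \<nu>0 - z * \<nu>1)"
proof (induction t)
  case 0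
  show "famp0 0 a b = of_real (cos (real 0 * \<omega>)) * \<nu>0 + \<i> * of_real (sin (real 0 * \<omega>)) * (z * \<nu>0 + w * \<nu>1)"
    "famp1 0 a b = of_real (cos (real 0 * \<omega>)) * \<nu>1 + \<i> * of_real (sin (real 0 * \<omega>)) * (cnj w * \<nu>0 - z * \<nu>1)"
    by (simp_all add: famp_0)
next
  case (Suc t)
  let ?S = "disp_sin (cos (2 * \<gamma>)) a b" and ?K = "disp_cos (cos (2 * \<gamma>)) a b"
  have "\<bar>?K\<bar> < 1" using disp_cos_sq_less_one[OF assms(1,2), of b] by (simp add: abs_square_less_1)
  then have \<omega>: "cos \<omega> = ?K" "sin \<omega> = ?S"
    unfolding \<omega>_def by (simp_all add: sin_arccos_abs disp_sin_def)
  have S: "0 < ?S" by (rule disp_sin_pos[OF assms(1,2)])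
  have n: "z * z + w * cnj w = 1"
    using axis_norm[OF assms(1,2), of b] unfolding z_def w_def complex_norm_square[symmetric]
    by (simp add: power2_eq_square flip: of_real_mult of_real_add of_real_power)
  have mz: "Complex ?K (rot_z \<gamma> a b) = of_real (cos \<omega>) + \<i> * of_real (sin \<omega>) * z" "Complex ?K (- rot_z \<gamma> a b) = of_real (cos \<omega>) - \<i> * of_real (sin \<omega>) * z"
    unfolding \<omega> z_def using S by (simp_all add: complex_eq_iff vel_y_def)
  have mw: "rot_w \<gamma> a b = of_real (sin \<omega>) * w" unfolding \<omega> w_def axis_w_def using S by simp
  have add: "cos (real (Suc t) * \<omega>) = cos \<omega> * cos (t * \<omega>) - sin \<omega> * sin (t * \<omega>)"
    "sin (real (Suc t) * \<omega>) = sin \<omega> * cos (t * \<omega>) + cos \<omega> * sin (t * \<omega>)"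
    by (simp_all add: distrib_right cos_add sin_add)
  have ii: "\<i> * \<i> = -1" by simp
  show "famp0 (Suc t) a b = of_real (cos (real (Suc t) * \<omega>)) * \<nu>0 + \<i> * of_real (sin (real (Suc t) * \<omega>)) * (z * \<nu>0 + w * \<nu>1)"
    unfolding famp_Suc mz mw Suc add complex_cnj_mult
    unfolding of_real_add of_real_diff of_real_mult complex_cnj_mult complex_cnj_complex_of_real
    using n ii by algebra
  show "famp1 (Suc t) a b = of_real (cos (real (Suc t) * \<omega>)) * \<nu>1 + \<i> * of_real (sin (real (Suc t) * \<omega>)) * (cnj w * \<nu>0 - z * \<nu>1)"
    unfolding famp_Suc mz mw Suc add complex_cnj_mult
    unfolding of_real_add of_real_diff of_real_mult complex_cnj_mult complex_cnj_complex_of_real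
    using n ii by algebra
qed

end

section \<open>Parseval identity on the quarter torus\<close>

text \<open>For nonzero even \<open>n\<close> the interval (0, \<pi>) covers whole periods, so the
  antiderivative agrees at both ends.\<close>

lemma integral_cis_even:
  assumes "even n"
  shows "(\<integral>b. indicator {0<..<pi} b *\<^sub>R cis (of_int n * b) \<partial>lborel) = (if n = 0 then of_real pi else 0)"
proof (cases "n = 0")
  case True
  then show ?thesis by (simp add: scaleR_conv_of_real)
next
  case False
  let ?F = "\<lambda>b. cis (of_int n * b) / (\<i> * of_int n)"
  have F: "(?F has_vector_derivative cis (of_int n * b)) (at b within A)" for b A
  proof -
    have "((\<lambda>b. cis (of_int n * b)) has_vector_derivative (\<i> * of_int n * cis (of_int n * b))) (at b within A)"
      unfolding has_vector_derivative_def
      by (rule derivative_eq_intros refl | simp add: scaleR_conv_of_real algebra_simps)+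
    from has_vector_derivative_divide[OF this, of "\<i> * of_int n"] show ?thesis using False by simp
  qed
  obtain m where m: "n = 2 * m" using assms by blast
  have "cis (of_int n * pi) = 1"
  proof -
    have "of_int n * pi = 2 * pi * of_int m" by (simp add: m)
    then show ?thesis by (simp only: cis_multiple_2pi Ints_of_int)
  qed
  then have "(LBINT b=ereal 0..ereal pi. cis (of_int n * b)) = 0"
    by (subst interval_integral_FTC_finite[where F = ?F]) (auto intro!: F continuous_intros)
  moreover have "(LBINT b=ereal 0..ereal pi. cis (of_int n * b)) = (\<integral>b. indicator {0<..<pi} b *\<^sub>R cis (of_int n * b) \<partial>lborel)"
    using interval_integral_Ioo[of "ereal 0" "ereal pi" "\<lambda>b. cis (of_int n * b)"]
    by (simp add: set_lebesgue_integral_def)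
  ultimately show ?thesis using False by simp
qed

lemma cis_measurable: "(\<lambda>z. cis (r * fst z + s * snd z)) \<in> borel_measurable (borel :: (real \<times> real) measure)"
  by (intro borel_measurable_continuous_onI continuous_intros)

lemma integrable_square_measure_bounded:
  fixes f :: "real \<times> real \<Rightarrow> 'a::{banach, second_countable_topology}"
  assumes "f \<in> borel_measurable borel" "\<And>z. z \<in> {0<..<pi} \<times> {0<..<pi} \<Longrightarrow> norm (f z) \<le> C"
  shows "integrable square_measure f"
  by (rule finite_measure.integrable_const_bound[OF finite_square_measure, where B = C])
     (use assms in \<open>auto intro!: AE_I2 measurable_square_measure\<close>)

lemma integral_square_cis:
  assumes "even m" "even n"
  shows "(\<integral>z. cis (of_int m * fst z + of_int n * snd z) \<partial>square_measure)
       = (if m = 0 \<and> n = 0 then of_real (pi\<^sup>2) else 0)"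
proof -
  let ?J = "\<lambda>n b. indicator {0<..<pi} b *\<^sub>R cis (of_int n * b)"
  let ?f = "\<lambda>z. indicator ({0<..<pi} \<times> {0<..<pi}) z *\<^sub>R cis (of_int m * fst z + of_int n * snd z)"
  have eq: "?f (a, b) = ?J m a * ?J n b" for a b
    by (simp add: indicator_times cis_mult scaleR_conv_of_real)
  have "integrable square_measure (\<lambda>z. cis (of_int m * fst z + of_int n * snd z))"
    by (rule integrable_square_measure_bounded[where C = 1]) (simp_all add: cis_measurable)
  then have "integrable lborel ?f"
    unfolding square_measure_def by (subst (asm) integrable_restrict_space) (auto simp: sets_square)
  then have i: "integrable (lborel \<Otimes>\<^sub>M lborel) ?f" unfolding lborel_prod .
  have "(\<integral>z. cis (of_int m * fst z + of_int n * snd z) \<partial>square_measure) = (\<integral>z. ?f z \<partial>(lborel \<Otimes>\<^sub>M lborel))"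
    unfolding integral_square_measure lborel_prod ..
  also have "\<dots> = (\<integral>a. \<integral>b. ?f (a, b) \<partial>lborel \<partial>lborel)"
    by (rule lborel_pair.integral_fst'[OF i, symmetric])
  also have "\<dots> = (\<integral>a. ?J m a \<partial>lborel) * (\<integral>b. ?J n b \<partial>lborel)"
    unfolding eq by (simp only: integral_mult_right_zero integral_mult_left_zero)
  also have "\<dots> = (if m = 0 \<and> n = 0 then of_real (pi\<^sup>2) else 0)"
    unfolding integral_cis_even[OF assms(1)] integral_cis_even[OF assms(2)]
    by (simp add: power2_eq_square)
  finally show ?thesis .
qed

text \<open>A momentum shift multiplies the mode at site \<open>p\<close> by the phase
  \<open>cis (\<alpha> * fst p + \<beta> * snd p)\<close>, and orthogonality of the modes keeps only
  the diagonal. Hence shifted overlaps are characteristic functions of the position.\<close>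

lemma parseval_shifted:
  assumes "parity_supp t f"
  shows "(\<integral>z. fourier t f (fst z - \<alpha>) (snd z - \<beta>) * cnj (fourier t f (fst z) (snd z)) \<partial>square_measure)
       = of_real (pi\<^sup>2) * (\<Sum>p\<in>site_box t. (cmod (f p))\<^sup>2 *\<^sub>R cis (\<alpha> * fst p + \<beta> * snd p))"
proof -
  let ?k = "\<lambda>p q. f p * cnj (f q) * cis (\<alpha> * fst p + \<beta> * snd p)"
  let ?e = "\<lambda>p q z. cis (of_int (fst q - fst p) * fst z + of_int (snd q - snd p) * snd z)"
  have "fourier t f (fst z - \<alpha>) (snd z - \<beta>) * cnj (fourier t f (fst z) (snd z))
      = (\<Sum>p\<in>site_box t. \<Sum>q\<in>site_box t. ?k p q * ?e p q z)" for z
    unfolding fourier_def cnj_sum sum_product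
  proof (intro sum.cong refl)
    fix p q :: "int \<times> int"
    have "- ((fst z - \<alpha>) * fst p + (snd z - \<beta>) * snd p) + (fst z * fst q + snd z * snd q)
      = (\<alpha> * fst p + \<beta> * snd p) + (of_int (fst q - fst p) * fst z + of_int (snd q - snd p) * snd z)"
      by (simp add: algebra_simps)
    then have "cis (- ((fst z - \<alpha>) * fst p + (snd z - \<beta>) * snd p)) * cis (fst z * fst q + snd z * snd q)
        = cis (\<alpha> * fst p + \<beta> * snd p) * ?e p q z" by (simp only: cis_mult)
    then show "f p * cis (- ((fst z - \<alpha>) * fst p + (snd z - \<beta>) * snd p)) * cnj (f q * cis (- (fst z * fst q + snd z * snd q)))
      = ?k p q * ?e p q z"
      unfolding complex_cnj_mult cis_cnj minus_minus by algebra
  qed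
  then have "(\<integral>z. fourier t f (fst z - \<alpha>) (snd z - \<beta>) * cnj (fourier t f (fst z) (snd z)) \<partial>square_measure)
      = (\<integral>z. (\<Sum>p\<in>site_box t. \<Sum>q\<in>site_box t. ?k p q * ?e p q z) \<partial>square_measure)" by simp
  also have "\<dots> = (\<Sum>p\<in>site_box t. \<Sum>q\<in>site_box t. ?k p q * (\<integral>z. ?e p q z \<partial>square_measure))"
  proof -
    have i: "integrable square_measure (\<lambda>z. ?k p q * ?e p q z)" for p q
      by (intro integrable_mult_right integrable_square_measure_bounded[where C = 1] cis_measurable) simp
    show ?thesis
      by (subst Bochner_Integration.integral_sum, intro Bochner_Integration.integrable_sum i,
          subst Bochner_Integration.integral_sum, rule i, simp)
  qed
  also have "\<dots> = (\<Sum>p\<in>site_box t. \<Sum>q\<in>site_box t. if q = p then of_real (pi\<^sup>2) * ((cmod (f p))\<^sup>2 *\<^sub>R cis (\<alpha> * fst p + \<beta> * snd p)) else 0)"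
  proof (intro sum.cong refl)
    fix p q :: "int \<times> int"
    show "?k p q * (\<integral>z. ?e p q z \<partial>square_measure)
        = (if q = p then of_real (pi\<^sup>2) * ((cmod (f p))\<^sup>2 *\<^sub>R cis (\<alpha> * fst p + \<beta> * snd p)) else 0)"
    \<comment> \<open>Two sites in the support have the parity of \<open>t\<close> in both
      coordinates, hence an even difference; otherwise both sides vanish.\<close>
    proof (cases "f p \<noteq> 0 \<and> f q \<noteq> 0")
      case True
      then have "even (fst p + int t)" "even (snd p + int t)" "even (fst q + int t)" "even (snd q + int t)"
        using assms unfolding parity_supp_def by blast+
      then have ev: "even (fst q - fst p)" "even (snd q - snd p)" by auto
      have "fst q - fst p = 0 \<and> snd q - snd p = 0 \<longleftrightarrow> q = p" by (auto simp: prod_eq_iff)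
      then show ?thesis unfolding integral_square_cis[OF ev]
        by (simp add: scaleR_conv_of_real complex_norm_square mult_ac flip: of_real_power)
    next
      case False
      then show ?thesis by auto
    qed
  qed
  also have "\<dots> = (\<Sum>p\<in>site_box t. of_real (pi\<^sup>2) * ((cmod (f p))\<^sup>2 *\<^sub>R cis (\<alpha> * fst p + \<beta> * snd p)))"
    by (simp add: sum.delta)
  finally show ?thesis by (simp add: sum_distrib_left)
qed

section \<open>Ballistic limit of the overlap\<close>

text \<open>With h = 1 / t the expression is a difference quotient at 0 of the phase along the
  direction (-\<xi>, -\<eta>), so its limit is minus the directional derivative.\<close>

lemma phase_tendsto:
  fixes a b \<xi> \<eta> :: real
  assumes "\<bar>\<kappa>\<bar> < 1" "sin a \<noteq> 0"
  shows "(\<lambda>t. real t * (arccos (disp_cos \<kappa> (a - \<xi> / real t) (b - \<eta> / real t)) - arccos (disp_cos \<kappa> a b)))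
    \<longlonglongrightarrow> - (\<xi> * vel_x \<kappa> a b + \<eta> * vel_y \<kappa> a b)"
proof -
  let ?w = "\<lambda>h. arccos (disp_cos \<kappa> (a - h * \<xi>) (b - h * \<eta>))"
  let ?K' = "\<xi> * (sin a * cos b + \<kappa> * cos a * sin b) + \<eta> * (\<kappa> * sin a * cos b + cos a * sin b)"
  have K: "\<bar>disp_cos \<kappa> a b\<bar> < 1" using disp_cos_sq_less_one[OF assms] by (simp add: abs_square_less_1)
  have S: "0 < disp_sin \<kappa> a b" by (rule disp_sin_pos[OF assms])
  have dK: "((\<lambda>h. disp_cos \<kappa> (a - h * \<xi>) (b - h * \<eta>)) has_real_derivative ?K') (at 0)"
    unfolding disp_cos_def by (auto intro!: derivative_eq_intros simp: algebra_simps)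
  have "(?w has_real_derivative (inverse (- sqrt (1 - (disp_cos \<kappa> a b)\<^sup>2)) * ?K')) (at 0)"
  proof (intro DERIV_chain2[OF _ dK])
    have "(arccos has_real_derivative inverse (- sqrt (1 - (disp_cos \<kappa> a b)\<^sup>2))) (at (disp_cos \<kappa> a b))"
      using K by (intro DERIV_arccos) auto
    then show "(arccos has_real_derivative inverse (- sqrt (1 - (disp_cos \<kappa> a b)\<^sup>2)))
      (at (disp_cos \<kappa> (a - 0 * \<xi>) (b - 0 * \<eta>)))" by simp
  qed
  moreover have "inverse (- sqrt (1 - (disp_cos \<kappa> a b)\<^sup>2)) * ?K' = - (\<xi> * vel_x \<kappa> a b + \<eta> * vel_y \<kappa> a b)"
    using S unfolding vel_x_def vel_y_def disp_sin_def[symmetric] by (simp add: field_simps)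
  ultimately have "((\<lambda>h. (?w h - ?w 0) / h) \<longlongrightarrow> - (\<xi> * vel_x \<kappa> a b + \<eta> * vel_y \<kappa> a b)) (at 0)"
    by (simp add: has_field_derivative_iff)
  \<comment> \<open>The value at \<open>t = 0\<close> is 0 by the convention for division and is
    excluded by restricting to positive \<open>t\<close>.\<close>
  moreover have "filterlim (\<lambda>t. 1 / real t) (at 0) sequentially"
    unfolding filterlim_at using lim_1_over_n
    by (auto intro!: eventually_mono[OF eventually_gt_at_top[of 0]])
  ultimately have "(\<lambda>t. (?w (1 / real t) - ?w 0) / (1 / real t)) \<longlonglongrightarrow> - (\<xi> * vel_x \<kappa> a b + \<eta> * vel_y \<kappa> a b)"
    by (rule filterlim_compose)
  then show ?thesis by (simp add: mult.commute)
qed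

lemma shifted_tendsto: "(\<lambda>t. a - \<xi> / real t) \<longlonglongrightarrow> a"
  using tendsto_diff[OF tendsto_const lim_const_over_n[of \<xi>], of a] by simp

lemma disp_sin_tendsto:
  assumes "a' \<longlonglongrightarrow> a" "b' \<longlonglongrightarrow> b"
  shows "(\<lambda>t. disp_sin \<kappa> (a' t) (b' t)) \<longlonglongrightarrow> disp_sin \<kappa> a b"
  unfolding disp_sin_def disp_cos_def by (intro tendsto_intros assms)

text \<open>Single phases of size t \<omega> oscillate, but their difference converges to -\<delta>.
  Replacing the involution at the shifted momentum by its limit costs an error tending to 0. The
  number \<open>m\<close> is the expectation of the involution in the initial coin state.\<close>

lemma famp_overlap_tendsto:
  fixes a b \<xi> \<eta> \<gamma> :: real and \<nu>0 \<nu>1 :: complex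
  defines "\<kappa> \<equiv> cos (2 * \<gamma>)"
  assumes k: "\<bar>\<kappa>\<bar> < 1" and a: "sin a \<noteq> 0" and nu: "(cmod \<nu>0)\<^sup>2 + (cmod \<nu>1)\<^sup>2 = 1"
  defines "\<delta> \<equiv> \<xi> * vel_x \<kappa> a b + \<eta> * vel_y \<kappa> a b"
    and "m \<equiv> ((cmod \<nu>0)\<^sup>2 - (cmod \<nu>1)\<^sup>2) * vel_y \<kappa> a b + 2 * Re (axis_w \<gamma> a b * \<nu>1 * cnj \<nu>0)"
  shows "(\<lambda>t. famp0 \<gamma> \<nu>0 \<nu>1 t (a - \<xi> / real t) (b - \<eta> / real t) * cnj (famp0 \<gamma> \<nu>0 \<nu>1 t a b)
            + famp1 \<gamma> \<nu>0 \<nu>1 t (a - \<xi> / real t) (b - \<eta> / real t) * cnj (famp1 \<gamma> \<nu>0 \<nu>1 t a b))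
    \<longlonglongrightarrow> of_real (cos \<delta>) - \<i> * of_real m * of_real (sin \<delta>)" (is "?I \<longlonglongrightarrow> _")
proof -
  define a' where "a' t = a - \<xi> / real t" for t
  define b' where "b' t = b - \<eta> / real t" for t
  have a': "a' \<longlonglongrightarrow> a" and b': "b' \<longlonglongrightarrow> b" unfolding a'_def b'_def by (rule shifted_tendsto)+
  define z where "z = complex_of_real (vel_y \<kappa> a b)"
  define w where "w = axis_w \<gamma> a b"
  define z' where "z' t = complex_of_real (vel_y \<kappa> (a' t) (b' t))" for t
  define w' where "w' t = axis_w \<gamma> (a' t) (b' t)" for t
  have S: "disp_sin \<kappa> a b \<noteq> 0" using disp_sin_pos[OF k a, of b] by simp
  have z': "z' \<longlonglongrightarrow> z" unfolding z'_def z_def vel_y_def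
    by (intro tendsto_intros disp_sin_tendsto a' b' S)
  have cis': "(\<lambda>t. cis (b' t)) \<longlonglongrightarrow> cis b"
    by (simp add: tendsto_complex_iff tendsto_cos tendsto_sin b')
  have w': "w' \<longlonglongrightarrow> w" unfolding w'_def w_def axis_w_def \<kappa>_def[symmetric]
    by (intro tendsto_intros disp_sin_tendsto a' b' S cis')
  define \<omega> where "\<omega> = arccos (disp_cos \<kappa> a b)"
  define \<omega>' where "\<omega>' t = arccos (disp_cos \<kappa> (a' t) (b' t))" for t
  \<comment> \<open>\<open>A\<close> and \<open>D\<close> are the components of the involution
    applied to the initial coin; the primed versions belong to the shifted momentum.\<close>
  define A where "A = z * \<nu>0 + w * \<nu>1"
  define D where "D = cnj w * \<nu>0 - z * \<nu>1"
  define A' where "A' t = z' t * \<nu>0 + w' t * \<nu>1" for t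
  define D' where "D' t = cnj (w' t) * \<nu>0 - z' t * \<nu>1" for t
  \<comment> \<open>\<open>X\<close> and \<open>Y\<close> collect the error of the primed
    components, tested against the image of the coin and against the coin itself.\<close>
  define X where "X t = (A' t - A) * cnj A + (D' t - D) * cnj D" for t
  define Y where "Y t = (A' t - A) * cnj \<nu>0 + (D' t - D) * cnj \<nu>1" for t
  have A': "A' \<longlonglongrightarrow> A" and D': "D' \<longlonglongrightarrow> D"
    unfolding A'_def A_def D'_def D_def by (intro tendsto_intros z' w')+
  have "X \<longlonglongrightarrow> (A - A) * cnj A + (D - D) * cnj D"
    unfolding X_def by (intro tendsto_intros A' D')
  then have X: "X \<longlonglongrightarrow> 0" by simp
  have "Y \<longlonglongrightarrow> (A - A) * cnj \<nu>0 + (D - D) * cnj \<nu>1"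
    unfolding Y_def by (intro tendsto_intros A' D')
  then have Y: "Y \<longlonglongrightarrow> 0" by simp
  have n: "z * z + w * cnj w = 1"
    using axis_norm[of \<gamma> a b] k a unfolding z_def w_def complex_norm_square[symmetric] \<kappa>_def
    by (simp add: power2_eq_square flip: of_real_mult of_real_add of_real_power)
  have cz: "cnj z = z" by (simp add: z_def)
  have nu': "\<nu>0 * cnj \<nu>0 + \<nu>1 * cnj \<nu>1 = 1"
    unfolding complex_norm_square[symmetric] of_real_add[symmetric] nu by simp
  have m1: "of_real m = A * cnj \<nu>0 + D * cnj \<nu>1"
  proof -
    have "of_real m = (\<nu>0 * cnj \<nu>0 - \<nu>1 * cnj \<nu>1) * z + (w * \<nu>1 * cnj \<nu>0 + cnj (w * \<nu>1 * cnj \<nu>0))"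
      unfolding m_def z_def w_def complex_add_cnj complex_norm_square[symmetric] by simp
    then show ?thesis unfolding A_def D_def by (simp add: algebra_simps)
  qed
  have m2: "of_real m = \<nu>0 * cnj A + \<nu>1 * cnj D"
  proof -
    have "cnj (of_real m) = cnj (A * cnj \<nu>0 + D * cnj \<nu>1)" unfolding m1 ..
    then show ?thesis by (simp add: mult.commute)
  qed
  \<comment> \<open>The involution is Hermitian, hence unitary, and preserves the norm of the
    coin.\<close>
  have AD: "A * cnj A + D * cnj D = 1"
  proof -
    have "A * cnj A + D * cnj D = (z * z + w * cnj w) * (\<nu>0 * cnj \<nu>0 + \<nu>1 * cnj \<nu>1)"
      unfolding A_def D_def by (simp add: cz algebra_simps)
    then show ?thesis unfolding n nu' by simp
  qed
  define E where "E t = of_real (sin (real t * \<omega>' t)) * (of_real (sin (real t * \<omega>)) * X t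
      + \<i> * of_real (cos (real t * \<omega>)) * Y t)" for t
  define d where "d t = real t * (\<omega>' t - \<omega>)" for t
  have d: "d \<longlonglongrightarrow> - \<delta>"
    unfolding d_def \<omega>'_def \<omega>_def a'_def b'_def \<delta>_def by (rule phase_tendsto[OF k a])
  have E: "E \<longlonglongrightarrow> 0"
  proof (rule Lim_null_comparison)
    have "norm (E t) \<le> norm (X t) + norm (Y t)" for t
    proof -
      have "norm (E t) \<le> 1 * (norm (of_real (sin (real t * \<omega>)) * X t) + norm (\<i> * of_real (cos (real t * \<omega>)) * Y t))"
        unfolding E_def norm_mult by (intro mult_mono norm_triangle_ineq) (auto simp: norm_mult intro: order_trans[OF norm_triangle_ineq])
      also have "\<dots> \<le> norm (X t) + norm (Y t)"
        by (simp add: norm_mult add_mono mult_left_le_one_le)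
      finally show ?thesis .
    qed
    then show "eventually (\<lambda>t. norm (E t) \<le> norm (X t) + norm (Y t)) sequentially" by simp
    show "(\<lambda>t. norm (X t) + norm (Y t)) \<longlonglongrightarrow> 0"
      using tendsto_add[OF tendsto_norm_zero[OF X] tendsto_norm_zero[OF Y]] by simp
  qed
  \<comment> \<open>The closed form at the shifted momentum needs a nonzero sine there, which is
    available for large \<open>t\<close>.\<close>
  have "eventually (\<lambda>t. sin (a' t) \<noteq> 0) sequentially"
    by (rule tendsto_imp_eventually_ne[OF tendsto_sin[OF a'] a])
  then have ev: "eventually (\<lambda>t. of_real (cos (d t)) + \<i> * of_real m * of_real (sin (d t)) + E t = ?I t) sequentially"
  proof eventually_elim
    case (elim t)
    define C where "C = complex_of_real (cos (real t * \<omega>))"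
    define s where "s = complex_of_real (sin (real t * \<omega>))"
    define C' where "C' = complex_of_real (cos (real t * \<omega>' t))"
    define s' where "s' = complex_of_real (sin (real t * \<omega>' t))"
    have dt: "d t = real t * \<omega>' t - real t * \<omega>" by (simp add: d_def right_diff_distrib)
    have trig: "complex_of_real (cos (d t)) = C' * C + s' * s" "complex_of_real (sin (d t)) = s' * C - C' * s"
      unfolding dt cos_diff sin_diff C_def s_def C'_def s'_def by simp_all
    have cl: "famp0 \<gamma> \<nu>0 \<nu>1 t a b = C * \<nu>0 + \<i> * s * A" "famp1 \<gamma> \<nu>0 \<nu>1 t a b = C * \<nu>1 + \<i> * s * D"
      using famp_closed[of \<gamma> a \<nu>0 \<nu>1 t b] k a
      unfolding C_def s_def A_def D_def z_def w_def \<omega>_def \<kappa>_def by simp_all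
    have cl': "famp0 \<gamma> \<nu>0 \<nu>1 t (a' t) (b' t) = C' * \<nu>0 + \<i> * s' * A' t"
      "famp1 \<gamma> \<nu>0 \<nu>1 t (a' t) (b' t) = C' * \<nu>1 + \<i> * s' * D' t"
      using famp_closed[of \<gamma> "a' t" \<nu>0 \<nu>1 t "b' t"] k elim
      unfolding C'_def s'_def A'_def D'_def z'_def w'_def \<omega>'_def \<kappa>_def by simp_all
    have cC: "cnj C = C" "cnj s = s" by (simp_all add: C_def s_def)
    have ii: "\<i> * \<i> = -1" by simp
    have "?I t = (C' * \<nu>0 + \<i> * s' * A' t) * (C * cnj \<nu>0 - \<i> * s * cnj A)
        + (C' * \<nu>1 + \<i> * s' * D' t) * (C * cnj \<nu>1 - \<i> * s * cnj D)"
      unfolding a'_def[symmetric] b'_def[symmetric] cl cl' by (simp add: cC)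
    also have "\<dots> = (C' * C + s' * s) + \<i> * of_real m * (s' * C - C' * s) + s' * (s * X t + \<i> * C * Y t)"
      using nu' AD m1 m2 ii unfolding X_def Y_def by algebra
    finally show ?case unfolding trig E_def C_def[symmetric] s_def[symmetric] s'_def[symmetric] by simp
  qed
  have "(\<lambda>t. of_real (cos (d t)) + \<i> * of_real m * of_real (sin (d t)) + E t)
      \<longlonglongrightarrow> of_real (cos (- \<delta>)) + \<i> * of_real m * of_real (sin (- \<delta>)) + 0"
    by (intro tendsto_intros d E)
  from Lim_transform_eventually[OF this ev] show ?thesis by simp
qed

section \<open>Convergence of distribution functions from characteristic functions\<close>

inductive trig_poly :: "(real \<times> real \<Rightarrow> real) \<Rightarrow> bool" where
  cos: "trig_poly (\<lambda>z. cos (\<xi> * fst z + \<eta> * snd z))"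
| sin: "trig_poly (\<lambda>z. sin (\<xi> * fst z + \<eta> * snd z))"
| add: "trig_poly f \<Longrightarrow> trig_poly g \<Longrightarrow> trig_poly (\<lambda>z. f z + g z)"
| scale: "trig_poly f \<Longrightarrow> trig_poly (\<lambda>z. c * f z)"

lemma trig_poly_continuous: "trig_poly f \<Longrightarrow> continuous_on A f"
  by (induction rule: trig_poly.induct) (auto intro!: continuous_intros)

text \<open>Product-to-sum formulas on the generators, then linearity. Differences are written as
  scaling by -1 to fit the introduction rules.\<close>

lemma trig_poly_mult_aux:
  assumes "trig_poly g"
  shows "trig_poly (\<lambda>z. cos (\<xi> * fst z + \<eta> * snd z) * g z)"
    and "trig_poly (\<lambda>z. sin (\<xi> * fst z + \<eta> * snd z) * g z)"
  using assms
proof (induction rule: trig_poly.induct)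
  case (cos \<xi>' \<eta>')
  have arg: "(\<xi> + \<xi>') * x + (\<eta> + \<eta>') * y = (\<xi> * x + \<eta> * y) + (\<xi>' * x + \<eta>' * y)"
    "(\<xi> - \<xi>') * x + (\<eta> - \<eta>') * y = (\<xi> * x + \<eta> * y) - (\<xi>' * x + \<eta>' * y)" for x y
    by (simp_all add: algebra_simps)
  have "trig_poly (\<lambda>z. (1/2) * (cos ((\<xi> - \<xi>') * fst z + (\<eta> - \<eta>') * snd z) + cos ((\<xi> + \<xi>') * fst z + (\<eta> + \<eta>') * snd z)))"
    by (intro trig_poly.intros)
  then show "trig_poly (\<lambda>z. cos (\<xi> * fst z + \<eta> * snd z) * cos (\<xi>' * fst z + \<eta>' * snd z))"
    by (simp only: arg cos_times_cos times_divide_eq_left mult_1_left mult_minus1 add_uminus_conv_diff)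
  have "trig_poly (\<lambda>z. (1/2) * (sin ((\<xi> + \<xi>') * fst z + (\<eta> + \<eta>') * snd z) + sin ((\<xi> - \<xi>') * fst z + (\<eta> - \<eta>') * snd z)))"
    by (intro trig_poly.intros)
  then show "trig_poly (\<lambda>z. sin (\<xi> * fst z + \<eta> * snd z) * cos (\<xi>' * fst z + \<eta>' * snd z))"
    by (simp only: arg sin_times_cos times_divide_eq_left mult_1_left mult_minus1 add_uminus_conv_diff)
next
  case (sin \<xi>' \<eta>')
  have arg: "(\<xi> + \<xi>') * x + (\<eta> + \<eta>') * y = (\<xi> * x + \<eta> * y) + (\<xi>' * x + \<eta>' * y)"
    "(\<xi> - \<xi>') * x + (\<eta> - \<eta>') * y = (\<xi> * x + \<eta> * y) - (\<xi>' * x + \<eta>' * y)" for x y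
    by (simp_all add: algebra_simps)
  have "trig_poly (\<lambda>z. (1/2) * (sin ((\<xi> + \<xi>') * fst z + (\<eta> + \<eta>') * snd z) + (-1) * sin ((\<xi> - \<xi>') * fst z + (\<eta> - \<eta>') * snd z)))"
    by (intro trig_poly.intros)
  then show "trig_poly (\<lambda>z. cos (\<xi> * fst z + \<eta> * snd z) * sin (\<xi>' * fst z + \<eta>' * snd z))"
    by (simp only: arg cos_times_sin times_divide_eq_left mult_1_left mult_minus1 add_uminus_conv_diff)
  have "trig_poly (\<lambda>z. (1/2) * (cos ((\<xi> - \<xi>') * fst z + (\<eta> - \<eta>') * snd z) + (-1) * cos ((\<xi> + \<xi>') * fst z + (\<eta> + \<eta>') * snd z)))"
    by (intro trig_poly.intros)
  then show "trig_poly (\<lambda>z. sin (\<xi> * fst z + \<eta> * snd z) * sin (\<xi>' * fst z + \<eta>' * snd z))"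
    by (simp only: arg sin_times_sin times_divide_eq_left mult_1_left mult_minus1 add_uminus_conv_diff)
next
  case (add f g)
  show "trig_poly (\<lambda>z. cos (\<xi> * fst z + \<eta> * snd z) * (f z + g z))"
    "trig_poly (\<lambda>z. sin (\<xi> * fst z + \<eta> * snd z) * (f z + g z))"
    unfolding distrib_left by (intro trig_poly.add add.IH)+
next
  case (scale f c)
  show "trig_poly (\<lambda>z. cos (\<xi> * fst z + \<eta> * snd z) * (c * f z))"
    "trig_poly (\<lambda>z. sin (\<xi> * fst z + \<eta> * snd z) * (c * f z))"
    unfolding mult.left_commute[of _ c] by (intro trig_poly.scale scale.IH)+
qed

lemma trig_poly_mult:
  assumes "trig_poly f" "trig_poly g" shows "trig_poly (\<lambda>z. f z * g z)"
  using assms(1)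
proof (induction rule: trig_poly.induct)
  case (add f1 f2)
  then show ?case unfolding distrib_right by (intro trig_poly.add)
next
  case (scale f c)
  then show ?case unfolding mult.assoc by (intro trig_poly.scale)
next
  case (cos \<xi> \<eta>)
  show ?case by (rule trig_poly_mult_aux(1)[OF assms(2)])
next
  case (sin \<xi> \<eta>)
  show ?case by (rule trig_poly_mult_aux(2)[OF assms(2)])
qed

text \<open>Stone-Weierstrass. The sines of the two coordinates separate points, since 1 < \<pi> / 2
  makes the sine injective on [-1, 1].\<close>

lemma trig_poly_dense:
  assumes "continuous_on (cbox (-1, -1) (1, 1)) \<phi>" "0 < e"
  obtains g where "trig_poly g" "\<And>z. z \<in> cbox (-1, -1) (1, 1) \<Longrightarrow> \<bar>\<phi> z - g z\<bar> < e"
proof -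
  let ?Q = "cbox (-1, -1) (1, 1) :: (real \<times> real) set"
  have const: "trig_poly (\<lambda>z. c)" for c
  proof -
    have "trig_poly (\<lambda>z. c * cos (0 * fst z + 0 * snd z))"
      by (rule trig_poly.scale, rule trig_poly.cos)
    then show ?thesis by simp
  qed
  have inj: "u = v" if "sin u = sin v" "\<bar>u\<bar> \<le> 1" "\<bar>v\<bar> \<le> 1" for u v :: real
  proof (rule sin_inj_pi)
    show "- (pi / 2) \<le> u" "u \<le> pi / 2" "- (pi / 2) \<le> v" "v \<le> pi / 2"
      using that(2,3) pi_gt3 by linarith+
  qed (rule that(1))
  have sep: "\<exists>h. trig_poly h \<and> h z \<noteq> h z'" if "z \<in> ?Q" "z' \<in> ?Q" "z \<noteq> z'" for z z'
  proof -
    have b: "\<bar>fst z\<bar> \<le> 1" "\<bar>fst z'\<bar> \<le> 1" "\<bar>snd z\<bar> \<le> 1" "\<bar>snd z'\<bar> \<le> 1"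
      using that by (auto simp: cbox_Pair_eq)
    show ?thesis
    proof (cases "fst z = fst z'")
      case False
      then have "sin (fst z) \<noteq> sin (fst z')" using inj b by blast
      moreover have "trig_poly (\<lambda>z. sin (fst z))" using trig_poly.sin[of 1 0] by simp
      ultimately show ?thesis by blast
    next
      case True
      then have "snd z \<noteq> snd z'" using that by (auto simp: prod_eq_iff)
      then have "sin (snd z) \<noteq> sin (snd z')" using inj b by blast
      moreover have "trig_poly (\<lambda>z. sin (snd z))" using trig_poly.sin[of 0 1] by simp
      ultimately show ?thesis by blast
    qed
  qed
  interpret function_ring_on "Collect trig_poly" ?Q
    by unfold_locales
       (simp_all add: compact_cbox trig_poly_continuous trig_poly.add trig_poly_mult const sep)
  show ?thesis using Stone_Weierstrass_basic[OF assms] that by blast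
qed

text \<open>The walk is abstracted to weights \<open>P t p\<close> at points \<open>X t p\<close> of
  the square. Convergence of the total mass is the case of zero frequencies in
  \<open>char\<close>.\<close>

locale char_convergence =
  fixes B :: "nat \<Rightarrow> 'p set" and P :: "nat \<Rightarrow> 'p \<Rightarrow> real" and X :: "nat \<Rightarrow> 'p \<Rightarrow> real \<times> real"
    and f :: "real \<times> real \<Rightarrow> real"
  assumes P_nonneg: "\<And>t p. 0 \<le> P t p"
    and X_box: "\<And>t p. p \<in> B t \<Longrightarrow> X t p \<in> cbox (-1, -1) (1, 1)"
    and f_int: "integrable lborel f"
    and f_supp: "\<And>z. f z \<noteq> 0 \<Longrightarrow> z \<in> cbox (-1, -1) (1, 1)"
    and char: "\<And>\<xi> \<eta>. (\<lambda>t. \<Sum>p\<in>B t. P t p *\<^sub>R cis (\<xi> * fst (X t p) + \<eta> * snd (X t p)))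
        \<longlonglongrightarrow> (\<integral>z. f z *\<^sub>R cis (\<xi> * fst z + \<eta> * snd z) \<partial>lborel)"
begin

lemma f_meas [measurable]: "f \<in> borel_measurable borel"
  using borel_measurable_integrable[OF f_int] by simp

text \<open>A continuous function is bounded on the compact square, and \<open>f\<close> vanishes
  outside it.\<close>

lemma integrable_mult_continuous:
  fixes \<phi> :: "real \<times> real \<Rightarrow> real"
  assumes "continuous_on UNIV \<phi>"
  shows "integrable lborel (\<lambda>z. f z * \<phi> z)"
proof -
  have [measurable]: "\<phi> \<in> borel_measurable borel" by (rule borel_measurable_continuous_onI[OF assms])
  have "compact (\<phi> ` cbox (-1, -1) (1, 1))"
    by (intro compact_continuous_image continuous_on_subset[OF assms]) auto
  then obtain M where M: "\<And>z. z \<in> cbox (-1, -1) (1, 1) \<Longrightarrow> \<bar>\<phi> z\<bar> \<le> M"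
    using compact_imp_bounded bounded_iff by (metis imageI real_norm_def)
  show ?thesis
  proof (rule Bochner_Integration.integrable_bound)
    show "integrable lborel (\<lambda>z. M * f z)" using f_int by simp
    have "\<bar>f z * \<phi> z\<bar> \<le> \<bar>M * f z\<bar>" for z
    proof (cases "f z = 0")
      case False
      then have "\<bar>\<phi> z\<bar> \<le> \<bar>M\<bar>" using M[OF f_supp] by fastforce
      then show ?thesis by (simp add: abs_mult mult.commute[of "\<bar>f z\<bar>"] mult_right_mono)
    qed simp
    then show "AE z in lborel. norm (f z * \<phi> z) \<le> norm (M * f z)" by simp
  qed simp
qed

lemma integrable_mult_cis: "integrable lborel (\<lambda>z. f z *\<^sub>R cis (\<xi> * fst z + \<eta> * snd z))"
  by (rule Bochner_Integration.integrable_bound[OF f_int]) (use cis_measurable in simp_all)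

lemma trig_poly_convergence:
  assumes "trig_poly g"
  shows "(\<lambda>t. \<Sum>p\<in>B t. P t p * g (X t p)) \<longlonglongrightarrow> (\<integral>z. f z * g z \<partial>lborel)"
  using assms
proof (induction rule: trig_poly.induct)
  case (cos \<xi> \<eta>)
  from tendsto_Re[OF char[of \<xi> \<eta>]] show ?case
    using integral_Re[OF integrable_mult_cis] by simp
next
  case (sin \<xi> \<eta>)
  from tendsto_Im[OF char[of \<xi> \<eta>]] show ?case
    using integral_Im[OF integrable_mult_cis] by simp
next
  case (add g h)
  have "(\<integral>z. f z * (g z + h z) \<partial>lborel) = (\<integral>z. f z * g z \<partial>lborel) + (\<integral>z. f z * h z \<partial>lborel)"
    unfolding distrib_left using add.hyps
    by (intro Bochner_Integration.integral_add integrable_mult_continuous trig_poly_continuous)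
  then show ?case using tendsto_add[OF add.IH] by (simp add: distrib_left sum.distrib)
next
  case (scale g c)
  then show ?case using tendsto_mult_left[OF scale.IH, of c]
    by (simp add: sum_distrib_left mult.left_commute[of _ c])
qed

text \<open>Approximation of \<open>\<phi>\<close> by a trigonometric polynomial, uniformly on the
  square that carries all the mass.\<close>

lemma continuous_convergence:
  assumes cont: "continuous_on UNIV \<phi>"
  shows "(\<lambda>t. \<Sum>p\<in>B t. P t p * \<phi> (X t p)) \<longlonglongrightarrow> (\<integral>z. f z * \<phi> z \<partial>lborel)"
proof (rule LIMSEQ_I)
  fix r :: real assume r: "0 < r"
  \<comment> \<open>\<open>M\<close> bounds the integral of the modulus of \<open>f\<close> and,
    being strictly larger than the limiting mass, also the total weight at late times. The choice of
    \<open>e\<close> then keeps each of three errors at most r / 4.\<close>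
  define M where "M = (\<integral>z. \<bar>f z\<bar> \<partial>lborel) + \<bar>\<integral>z. f z \<partial>lborel\<bar> + 1"
  have M: "0 < M" unfolding M_def by (simp add: add_nonneg_pos)
  define e where "e = r / (4 * M)"
  have e: "0 < e" "e * M = r / 4" using r M by (simp_all add: e_def)
  obtain g where g: "trig_poly g" "\<And>z. z \<in> cbox (-1, -1) (1, 1) \<Longrightarrow> \<bar>\<phi> z - g z\<bar> < e"
    using trig_poly_dense[OF continuous_on_subset[OF cont] e(1)] by blast
  have mass: "(\<lambda>t. \<Sum>p\<in>B t. P t p) \<longlonglongrightarrow> (\<integral>z. f z \<partial>lborel)"
    using trig_poly_convergence[OF trig_poly.cos[of 0 0]] by simp
  have "(\<integral>z. f z \<partial>lborel) < M"
  proof -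
    have "0 \<le> (\<integral>z. \<bar>f z\<bar> \<partial>lborel)" by (rule integral_nonneg_AE) simp
    then show ?thesis unfolding M_def by linarith
  qed
  then have "eventually (\<lambda>t. (\<Sum>p\<in>B t. P t p) < M) sequentially"
    using order_tendstoD(2)[OF mass] by simp
  moreover have "eventually (\<lambda>t. \<bar>(\<Sum>p\<in>B t. P t p * g (X t p)) - (\<integral>z. f z * g z \<partial>lborel)\<bar> < r / 4) sequentially"
    using tendstoD[OF trig_poly_convergence[OF g(1)], of "r / 4"] r by (simp add: dist_real_def)
  ultimately have "eventually (\<lambda>t. \<bar>(\<Sum>p\<in>B t. P t p * \<phi> (X t p)) - (\<integral>z. f z * \<phi> z \<partial>lborel)\<bar> < r) sequentially"
  proof eventually_elim
    case (elim t)
    have "\<bar>(\<Sum>p\<in>B t. P t p * \<phi> (X t p)) - (\<Sum>p\<in>B t. P t p * g (X t p))\<bar>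
        = \<bar>\<Sum>p\<in>B t. P t p * (\<phi> (X t p) - g (X t p))\<bar>"
      by (simp add: sum_subtractf right_diff_distrib)
    also have "\<dots> \<le> (\<Sum>p\<in>B t. P t p * e)"
    proof (intro order_trans[OF sum_abs] sum_mono)
      fix p assume "p \<in> B t"
      then have "\<bar>\<phi> (X t p) - g (X t p)\<bar> \<le> e" using g(2)[OF X_box] by fastforce
      then show "\<bar>P t p * (\<phi> (X t p) - g (X t p))\<bar> \<le> P t p * e"
        using P_nonneg[of t p] by (simp add: abs_mult mult_left_mono)
    qed
    also have "\<dots> \<le> M * e"
      unfolding sum_distrib_right[symmetric] using elim(1) e(1) by (intro mult_right_mono) auto
    finally have 1: "\<bar>(\<Sum>p\<in>B t. P t p * \<phi> (X t p)) - (\<Sum>p\<in>B t. P t p * g (X t p))\<bar> \<le> r / 4"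
      using e(2) by (simp add: mult.commute)
    note ig = integrable_mult_continuous[OF trig_poly_continuous[OF g(1)]]
    have "\<bar>(\<integral>z. f z * g z \<partial>lborel) - (\<integral>z. f z * \<phi> z \<partial>lborel)\<bar> = \<bar>\<integral>z. f z * (g z - \<phi> z) \<partial>lborel\<bar>"
      unfolding right_diff_distrib
      by (subst Bochner_Integration.integral_diff[OF ig integrable_mult_continuous[OF cont]]) simp
    also have "\<dots> \<le> (\<integral>z. e * \<bar>f z\<bar> \<partial>lborel)"
    proof -
      have "\<bar>f z * (g z - \<phi> z)\<bar> \<le> e * \<bar>f z\<bar>" for z
      proof (cases "f z = 0")
        case False
        then have "\<bar>g z - \<phi> z\<bar> \<le> e" using g(2)[OF f_supp[OF False]] by linarith
        then show ?thesis by (simp add: abs_mult mult.commute[of "\<bar>f z\<bar>"] mult_right_mono)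
      qed simp
      moreover have "integrable lborel (\<lambda>z. e * \<bar>f z\<bar>)" using f_int by simp
      ultimately show ?thesis
        by (intro order_trans[OF integral_abs_bound] integral_mono') (simp_all add: less_imp_le[OF e(1)])
    qed
    also have "\<dots> \<le> e * M" unfolding M_def using e(1) by (simp add: less_imp_le)
    finally have 2: "\<bar>(\<integral>z. f z * g z \<partial>lborel) - (\<integral>z. f z * \<phi> z \<partial>lborel)\<bar> \<le> r / 4" using e(2) by simp
    show ?case using 1 2 elim(2) r by linarith
  qed
  then show "\<exists>N. \<forall>t\<ge>N. norm ((\<Sum>p\<in>B t. P t p * \<phi> (X t p)) - (\<integral>z. f z * \<phi> z \<partial>lborel)) < r"
    by (simp add: eventually_sequentially)
qed

end

section \<open>From continuous test functions to quadrants\<close>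

lemma eventually_one_le_mult:
  assumes "0 < d" shows "eventually (\<lambda>n. 1 \<le> real n * d) sequentially"
proof -
  obtain N where "1 < real N * d" using reals_Archimedean3[OF assms] by blast
  moreover have "real N * d \<le> real n * d" if "N \<le> n" for n using that assms by simp
  ultimately show ?thesis unfolding eventually_sequentially by (meson less_imp_le order_trans)
qed

text \<open>Continuous majorant of the indicator of \<open>{..r}\<close>, falling linearly from 1 to
  0 over length 1 / n to the right of \<open>r\<close> for positive \<open>n\<close>;
  \<open>ramp_below\<close> is the minorant, using the same length to the left of
  \<open>r\<close>.\<close>

definition ramp_above :: "nat \<Rightarrow> real \<Rightarrow> real \<Rightarrow> real" where
  "ramp_above n r u = max 0 (min 1 (1 - real n * (u - r)))"

definition ramp_below :: "nat \<Rightarrow> real \<Rightarrow> real \<Rightarrow> real" where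
  "ramp_below n r u = max 0 (min 1 (real n * (r - u)))"

lemma ramp_bounds:
  "0 \<le> ramp_above n r u" "ramp_above n r u \<le> 1" "0 \<le> ramp_below n r u" "ramp_below n r u \<le> 1"
  by (auto simp: ramp_above_def ramp_below_def)

lemma ramp_above_eq_one: "u \<le> r \<Longrightarrow> ramp_above n r u = 1"
  by (simp add: ramp_above_def mult_nonneg_nonpos)

lemma ramp_below_eq_zero: "r \<le> u \<Longrightarrow> ramp_below n r u = 0"
  using mult_nonneg_nonpos[of "real n" "r - u"] by (simp add: ramp_below_def)

lemma ramp_above_tendsto: "(\<lambda>n. ramp_above n r u) \<longlonglongrightarrow> indicator {..r} u"
proof (cases "u \<le> r")
  case True
  then show ?thesis by (simp add: ramp_above_eq_one)
next
  case False
  then have "eventually (\<lambda>n. ramp_above n r u = 0) sequentially"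
    using eventually_one_le_mult[of "u - r"] by (auto elim!: eventually_mono simp: ramp_above_def)
  then show ?thesis using False by (auto intro: tendsto_eventually)
qed

lemma ramp_below_tendsto: "(\<lambda>n. ramp_below n r u) \<longlonglongrightarrow> indicator {..<r} u"
proof (cases "r \<le> u")
  case True
  then show ?thesis by (simp add: ramp_below_eq_zero)
next
  case False
  then have "eventually (\<lambda>n. ramp_below n r u = 1) sequentially"
    using eventually_one_le_mult[of "r - u"] by (auto elim!: eventually_mono simp: ramp_below_def)
  then show ?thesis using False by (auto intro: tendsto_eventually)
qed

text \<open>The boundary of a quadrant lies on two null lines, so a law with a density does not
  charge it.\<close>

lemma AE_lborel_fst_snd_neq: "AE z in lborel. fst z \<noteq> (x::real) \<and> snd z \<noteq> (y::real)"
proof -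
  have "AE u in lborel. AE v in lborel. u \<noteq> x \<and> v \<noteq> y"
    using AE_lborel_singleton[of x] by eventually_elim (use AE_lborel_singleton[of y] in simp)
  then have "AE z in lborel \<Otimes>\<^sub>M lborel. fst z \<noteq> x \<and> snd z \<noteq> y"
  proof (intro lborel_pair.AE_pair_measure)
    show "{z \<in> space (lborel \<Otimes>\<^sub>M lborel). fst z \<noteq> x \<and> snd z \<noteq> y} \<in> sets (lborel \<Otimes>\<^sub>M lborel)"
      by measurable
  qed simp
  then show ?thesis unfolding lborel_prod .
qed

context char_convergence
begin

text \<open>The distribution function is squeezed between integrals of products of ramps, for which
  convergence in \<open>t\<close> is known.\<close>

theorem cdf_convergence:
  assumes fin: "\<And>t. finite (B t)"
  shows "(\<lambda>t. \<Sum>p\<in>{p \<in> B t. fst (X t p) \<le> x \<and> snd (X t p) \<le> y}. P t p)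
    \<longlonglongrightarrow> (\<integral>z. f z * indicator ({..x} \<times> {..y}) z \<partial>lborel)"
    (is "?C \<longlonglongrightarrow> ?I")
proof -
  define U where "U n z = ramp_above n x (fst z) * ramp_above n y (snd z)" for n z
  define L where "L n z = ramp_below n x (fst z) * ramp_below n y (snd z)" for n z
  have contU: "continuous_on UNIV (U n)" and contL: "continuous_on UNIV (L n)" for n
    unfolding U_def L_def ramp_above_def ramp_below_def by (auto intro!: continuous_intros)
  note [measurable] = borel_measurable_continuous_onI[OF contU] borel_measurable_continuous_onI[OF contL]
  have UL: "0 \<le> U n z" "U n z \<le> 1" "0 \<le> L n z" "L n z \<le> 1" for n z
    unfolding U_def L_def using ramp_bounds by (auto intro!: mult_nonneg_nonneg mult_le_one)
  have absf: "integrable lborel (\<lambda>z. \<bar>f z\<bar>)" using f_int by simp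
  have [measurable]: "{..x} \<times> {..y} \<in> sets (borel :: (real \<times> real) measure)"
    "{..<x} \<times> {..<y} \<in> sets (borel :: (real \<times> real) measure)"
    by (intro borel_closed closed_Times closed_atMost)
       (intro borel_open open_Times open_lessThan)
  have "(\<lambda>n. \<integral>z. f z * U n z \<partial>lborel) \<longlonglongrightarrow> ?I"
  proof (rule integral_dominated_convergence[OF _ _ absf])
    show "AE z in lborel. (\<lambda>n. f z * U n z) \<longlonglongrightarrow> f z * indicator ({..x} \<times> {..y}) z"
      unfolding U_def indicator_times by (intro AE_I2 tendsto_intros ramp_above_tendsto)
    show "AE z in lborel. norm (f z * U n z) \<le> \<bar>f z\<bar>" for n
      using UL by (simp add: abs_mult mult_left_le)
  qed simp_all
  moreover have "(\<lambda>n. \<integral>z. f z * L n z \<partial>lborel) \<longlonglongrightarrow> (\<integral>z. f z * indicator ({..<x} \<times> {..<y}) z \<partial>lborel)"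
  proof (rule integral_dominated_convergence[OF _ _ absf])
    show "AE z in lborel. (\<lambda>n. f z * L n z) \<longlonglongrightarrow> f z * indicator ({..<x} \<times> {..<y}) z"
      unfolding L_def indicator_times by (intro AE_I2 tendsto_intros ramp_below_tendsto)
    show "AE z in lborel. norm (f z * L n z) \<le> \<bar>f z\<bar>" for n
      using UL by (simp add: abs_mult mult_left_le)
  qed simp_all
  \<comment> \<open>The minorants tend to the open quadrant and the majorants to the closed one;
    both limits agree because the boundary is null.\<close>
  moreover have "(\<integral>z. f z * indicator ({..<x} \<times> {..<y}) z \<partial>lborel) = ?I"
    by (intro integral_cong_AE, simp, simp, use AE_lborel_fst_snd_neq[of x y] in eventually_elim)
       (auto simp: indicator_def mem_Times_iff)
  ultimately have limU: "(\<lambda>n. \<integral>z. f z * U n z \<partial>lborel) \<longlonglongrightarrow> ?I"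
    and limL: "(\<lambda>n. \<integral>z. f z * L n z \<partial>lborel) \<longlonglongrightarrow> ?I" by simp_all
  have C_eq: "?C t = (\<Sum>p\<in>B t. P t p * indicator ({..x} \<times> {..y}) (X t p))" for t
    unfolding sum.inter_filter[OF fin] by (intro sum.cong) (auto simp: indicator_def mem_Times_iff)
  have CU: "?C t \<le> (\<Sum>p\<in>B t. P t p * U n (X t p))" for n t
    unfolding C_eq
  proof (intro sum_mono mult_left_mono P_nonneg)
    show "indicator ({..x} \<times> {..y}) z \<le> U n z" for z
      using UL by (auto simp: indicator_def U_def ramp_above_eq_one mem_Times_iff)
  qed
  have CL: "(\<Sum>p\<in>B t. P t p * L n (X t p)) \<le> ?C t" for n t
    unfolding C_eq
  proof (intro sum_mono mult_left_mono P_nonneg)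
    show "L n z \<le> indicator ({..x} \<times> {..y}) z" for z
      using UL(4)[of n z] by (auto simp: indicator_def L_def ramp_below_eq_zero mem_Times_iff)
  qed
  show ?thesis
  proof (rule order_tendstoI)
    \<comment> \<open>First \<open>n\<close> is fixed so that the limiting integral of the majorant
      is already below \<open>a\<close>; only then is \<open>t\<close> taken large.\<close>
    fix a assume "?I < a"
    then obtain n where "(\<integral>z. f z * U n z \<partial>lborel) < a"
      using eventually_happens'[OF _ order_tendstoD(2)[OF limU]] by auto
    then have "eventually (\<lambda>t. (\<Sum>p\<in>B t. P t p * U n (X t p)) < a) sequentially"
      using order_tendstoD(2)[OF continuous_convergence[OF contU]] by blast
    then show "eventually (\<lambda>t. ?C t < a) sequentially"
      by eventually_elim (use CU in \<open>blast intro: le_less_trans\<close>)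
  next
    fix a assume "a < ?I"
    then obtain n where "a < (\<integral>z. f z * L n z \<partial>lborel)"
      using eventually_happens'[OF _ order_tendstoD(1)[OF limL]] by auto
    then have "eventually (\<lambda>t. a < (\<Sum>p\<in>B t. P t p * L n (X t p))) sequentially"
      using order_tendstoD(1)[OF continuous_convergence[OF contL]] by blast
    then show "eventually (\<lambda>t. a < ?C t) sequentially"
      by eventually_elim (use CL in \<open>blast intro: less_le_trans\<close>)
  qed
qed

end

section \<open>The limit law\<close>

text \<open>Replacing both sides by their supplements leaves \<open>disp_cos\<close> unchanged, so
  the gradient of the phase changes sign.\<close>

lemma vel_reflect: "vel \<kappa> ((pi, pi) - z) = - vel \<kappa> z"
proof -
  obtain a b where z: "z = (a, b)" by (cases z)
  have S: "disp_sin \<kappa> (pi - a) (pi - b) = disp_sin \<kappa> a b"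
    by (simp add: disp_sin_def disp_cos_def)
  have "sin (pi - a) * cos (pi - b) + \<kappa> * cos (pi - a) * sin (pi - b) = - (sin a * cos b + \<kappa> * cos a * sin b)"
    "\<kappa> * sin (pi - a) * cos (pi - b) + cos (pi - a) * sin (pi - b) = - (\<kappa> * sin a * cos b + cos a * sin b)"
    by simp_all
  then show ?thesis unfolding z vel_def vel_x_def vel_y_def by (simp only: fst_conv snd_conv diff_Pair S minus_divide_left uminus_Pair)
qed

lemma vel_in_cbox:
  assumes "\<bar>\<kappa>\<bar> < 1" "z \<in> {0<..<pi} \<times> {0<..<pi}"
  shows "vel \<kappa> z \<in> cbox (-1, -1) (1, 1)"
proof -
  have a: "sin (fst z) \<noteq> 0" using assms(2) sin_gt_zero[of "fst z"] by (auto simp: mem_Times_iff)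
  have k: "0 \<le> 1 - \<kappa>\<^sup>2" using one_minus_sq_pos[OF assms(1)] by simp
  have "0 \<le> 1 - (vel_x \<kappa> (fst z) (snd z))\<^sup>2" "0 \<le> 1 - (vel_y \<kappa> (fst z) (snd z))\<^sup>2"
    unfolding one_minus_vel_x_sq[OF assms(1) a] one_minus_vel_y_sq[OF assms(1) a] using k by simp_all
  then have "\<bar>vel_x \<kappa> (fst z) (snd z)\<bar> \<le> 1" "\<bar>vel_y \<kappa> (fst z) (snd z)\<bar> \<le> 1"
    by (simp_all add: abs_square_le_1)
  then show ?thesis by (auto simp: vel_def cbox_Pair_eq)
qed

lemma integrable_continuous_vel:
  fixes H :: "real \<times> real \<Rightarrow> 'a::{banach, second_countable_topology}"
  assumes "\<bar>\<kappa>\<bar> < 1" "continuous_on UNIV H"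
  shows "integrable square_measure (\<lambda>z. H (vel \<kappa> z))"
proof -
  have "compact (H ` cbox (-1, -1) (1, 1))"
    by (intro compact_continuous_image continuous_on_subset[OF assms(2)]) auto
  then obtain C where C: "\<And>z. z \<in> cbox (-1, -1) (1, 1) \<Longrightarrow> norm (H z) \<le> C"
    using compact_imp_bounded bounded_iff by (metis imageI)
  show ?thesis
  proof (rule integrable_square_measure_bounded)
    show "(\<lambda>z. H (vel \<kappa> z)) \<in> borel_measurable borel"
      by (rule measurable_compose[OF measurable_vel borel_measurable_continuous_onI[OF assms(2)]])
    show "norm (H (vel \<kappa> z)) \<le> C" if "z \<in> {0<..<pi} \<times> {0<..<pi}" for z
      by (rule C[OF vel_in_cbox[OF assms(1) that]])
  qed
qed

text \<open>The part of the expectation of the involution that depends on the velocity alone. Along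
  \<open>vel\<close>, the last factor divided by \<open>sin (2 * \<gamma>)\<close> is the real part
  of \<open>axis_w\<close>.\<close>

definition drift :: "real \<Rightarrow> complex \<Rightarrow> complex \<Rightarrow> real \<times> real \<Rightarrow> real" where
  "drift \<gamma> \<nu>0 \<nu>1 z = ((cmod \<nu>0)\<^sup>2 - (cmod \<nu>1)\<^sup>2) * snd z
     + 2 * Re (\<nu>1 * cnj \<nu>0) / sin (2 * \<gamma>) * (fst z - cos (2 * \<gamma>) * snd z)"

lemma drift_continuous [continuous_intros]: "continuous_on A (drift \<gamma> \<nu>0 \<nu>1)"
  unfolding drift_def by (intro continuous_intros)

lemma drift_uminus: "drift \<gamma> \<nu>0 \<nu>1 (- z) = - drift \<gamma> \<nu>0 \<nu>1 z"
proof -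
  have "p * (- v) + q * (- u - k * (- v)) = - (p * v + q * (u - k * v))" for p q k u v :: real
    by (simp add: algebra_simps)
  then show ?thesis unfolding drift_def fst_uminus snd_uminus .
qed

text \<open>Pure algebra with \<kappa> = cos (2 \<gamma>): the two descriptions of the ellipse
  agree, and the bracket in the initial-state term is \<open>x - \<kappa> * y\<close>.\<close>

lemma limit_density_eq:
  assumes "sin (2 * \<gamma>) \<noteq> 0"
  shows "limit_density \<gamma> \<nu>0 \<nu>1 (fst z) (snd z)
    = base_density (cos (2 * \<gamma>)) z * ((1 - drift \<gamma> \<nu>0 \<nu>1 z) / pi\<^sup>2)"
proof -
  define c where "c = cos \<gamma>"
  define s where "s = sin \<gamma>"
  have cs: "c \<noteq> 0" "s \<noteq> 0" "sin (2 * \<gamma>) = 2 * c * s" using assms by (auto simp: sin_double c_def s_def)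
  have one: "s\<^sup>2 = 1 - c\<^sup>2" by (simp add: c_def s_def sin_squared_eq)
  have \<kappa>: "cos (2 * \<gamma>) = c\<^sup>2 - s\<^sup>2" by (simp add: cos_double c_def s_def)
  obtain x y where z: "z = (x, y)" by (cases z)
  have "(x, y) \<in> domD \<gamma> \<longleftrightarrow> (x, y) \<in> ellipse (cos (2 * \<gamma>))"
  proof -
    have "(x, y) \<in> domD \<gamma> \<longleftrightarrow> (x + y)\<^sup>2 / (4 * c\<^sup>2) + (x - y)\<^sup>2 / (4 * s\<^sup>2) < 1"
      by (simp add: domD_def c_def s_def)
    also have "(x + y)\<^sup>2 / (4 * c\<^sup>2) + (x - y)\<^sup>2 / (4 * s\<^sup>2) = ((x + y)\<^sup>2 * s\<^sup>2 + (x - y)\<^sup>2 * c\<^sup>2) / (4 * (c\<^sup>2 * s\<^sup>2))"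
      using cs by (simp add: add_frac_eq divide_simps)
    also have "\<dots> < 1 \<longleftrightarrow> (x + y)\<^sup>2 * s\<^sup>2 + (x - y)\<^sup>2 * c\<^sup>2 < 4 * (c\<^sup>2 * s\<^sup>2)"
      using cs by (simp add: pos_divide_less_eq)
    \<comment> \<open>The two sides of both inequalities have the same difference once
      \<open>s\<^sup>2 = 1 - c\<^sup>2\<close> is inserted.\<close>
    also have "\<dots> \<longleftrightarrow> (y - (c\<^sup>2 - s\<^sup>2) * x)\<^sup>2 < (1 - (c\<^sup>2 - s\<^sup>2)\<^sup>2) * (1 - x\<^sup>2)"
    proof -
      have "(1 - (c\<^sup>2 - s\<^sup>2)\<^sup>2) * (1 - x\<^sup>2) - (y - (c\<^sup>2 - s\<^sup>2) * x)\<^sup>2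
          = 4 * (c\<^sup>2 * s\<^sup>2) - ((x + y)\<^sup>2 * s\<^sup>2 + (x - y)\<^sup>2 * c\<^sup>2)"
        unfolding one by (simp add: power2_eq_square algebra_simps)
      then show ?thesis by linarith
    qed
    finally show ?thesis unfolding \<kappa> by (simp add: ellipse_def)
  qed
  then have ind: "indicator (domD \<gamma>) (x, y) = (indicator (ellipse (cos (2 * \<gamma>))) (x, y) :: real)"
    by (simp add: indicator_def)
  have "c\<^sup>2 * (x - y) + s\<^sup>2 * (x + y) = x - (c\<^sup>2 - s\<^sup>2) * y"
    unfolding one by (simp add: algebra_simps)
  moreover have "Re (\<nu>0 * cnj \<nu>1 + cnj \<nu>0 * \<nu>1) = 2 * Re (\<nu>1 * cnj \<nu>0)" by (simp add: algebra_simps)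
  ultimately show ?thesis
    unfolding limit_density_def Let_def z fst_conv snd_conv base_density_def drift_def ind
      c_def[symmetric] s_def[symmetric] \<kappa> cs(3) by (simp add: mult_ac diff_diff_eq)
qed

section \<open>The characteristic function as a momentum integral\<close>

lemma famp_measurable:
  "(\<lambda>z. famp0 \<gamma> \<nu>0 \<nu>1 t (fst z - \<alpha>) (snd z - \<beta>)) \<in> borel_measurable borel"
  "(\<lambda>z. famp1 \<gamma> \<nu>0 \<nu>1 t (fst z - \<alpha>) (snd z - \<beta>)) \<in> borel_measurable borel"
  unfolding famp0_def famp1_def fourier_def
  by (intro borel_measurable_continuous_onI continuous_intros)+

lemma norm_famp_le_one:
  assumes "(cmod \<nu>0)\<^sup>2 + (cmod \<nu>1)\<^sup>2 = 1"
  shows "norm (famp0 \<gamma> \<nu>0 \<nu>1 t a b) \<le> 1" "norm (famp1 \<gamma> \<nu>0 \<nu>1 t a b) \<le> 1"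
proof -
  have "(cmod (famp0 \<gamma> \<nu>0 \<nu>1 t a b))\<^sup>2 + (cmod (famp1 \<gamma> \<nu>0 \<nu>1 t a b))\<^sup>2 = 1"
    unfolding famp_norm by (rule assms)
  then have "(cmod (famp0 \<gamma> \<nu>0 \<nu>1 t a b))\<^sup>2 \<le> 1" "(cmod (famp1 \<gamma> \<nu>0 \<nu>1 t a b))\<^sup>2 \<le> 1"
    using zero_le_power2[of "cmod (famp0 \<gamma> \<nu>0 \<nu>1 t a b)"] zero_le_power2[of "cmod (famp1 \<gamma> \<nu>0 \<nu>1 t a b)"]
    by linarith+
  then show "norm (famp0 \<gamma> \<nu>0 \<nu>1 t a b) \<le> 1" "norm (famp1 \<gamma> \<nu>0 \<nu>1 t a b) \<le> 1"
    by (simp_all add: power_le_one_iff abs_square_le_1)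
qed

text \<open>The inner product on the coin space of the Fourier states at the shifted and the
  original momentum.\<close>

definition overlap :: "real \<Rightarrow> complex \<Rightarrow> complex \<Rightarrow> real \<Rightarrow> real \<Rightarrow> nat \<Rightarrow> real \<times> real \<Rightarrow> complex" where
  "overlap \<gamma> \<nu>0 \<nu>1 \<xi> \<eta> t z =
     famp0 \<gamma> \<nu>0 \<nu>1 t (fst z - \<xi> / real t) (snd z - \<eta> / real t) * cnj (famp0 \<gamma> \<nu>0 \<nu>1 t (fst z) (snd z))
   + famp1 \<gamma> \<nu>0 \<nu>1 t (fst z - \<xi> / real t) (snd z - \<eta> / real t) * cnj (famp1 \<gamma> \<nu>0 \<nu>1 t (fst z) (snd z))"

lemma cnj_measurable:
  assumes [measurable]: "f \<in> borel_measurable M" shows "(\<lambda>z. cnj (f z)) \<in> borel_measurable M"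
proof -
  have [measurable]: "cnj \<in> borel_measurable borel" by (intro borel_measurable_continuous_onI continuous_intros)
  show ?thesis by measurable
qed

lemma overlap_measurable [measurable]: "overlap \<gamma> \<nu>0 \<nu>1 \<xi> \<eta> t \<in> borel_measurable borel"
  unfolding overlap_def
  using famp_measurable[of \<gamma> \<nu>0 \<nu>1 t 0 0]
  by (intro borel_measurable_add borel_measurable_times famp_measurable cnj_measurable) simp_all

text \<open>Parseval with shift (\<xi> / t, \<eta> / t) for each coin component; adding the
  components traces out the coin.\<close>

lemma char_eq_overlap:
  assumes "(cmod \<nu>0)\<^sup>2 + (cmod \<nu>1)\<^sup>2 = 1"
  shows "(\<integral>z. overlap \<gamma> \<nu>0 \<nu>1 \<xi> \<eta> t z \<partial>square_measure) = of_real (pi\<^sup>2) *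
    (\<Sum>p\<in>site_box t. walk_prob \<gamma> \<nu>0 \<nu>1 t (fst p) (snd p) *\<^sub>R cis (\<xi> * (fst p / real t) + \<eta> * (snd p / real t)))"
proof -
  have i: "integrable square_measure (\<lambda>z. famp0 \<gamma> \<nu>0 \<nu>1 t (fst z - \<xi> / real t) (snd z - \<eta> / real t) * cnj (famp0 \<gamma> \<nu>0 \<nu>1 t (fst z) (snd z)))"
    "integrable square_measure (\<lambda>z. famp1 \<gamma> \<nu>0 \<nu>1 t (fst z - \<xi> / real t) (snd z - \<eta> / real t) * cnj (famp1 \<gamma> \<nu>0 \<nu>1 t (fst z) (snd z)))"
    using famp_measurable[of \<gamma> \<nu>0 \<nu>1 t 0 0] norm_famp_le_one[OF assms, of \<gamma> t]
    by (auto intro!: integrable_square_measure_bounded[where C = 1] borel_measurable_times famp_measurable cnj_measurable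
        mult_le_one simp: norm_mult)
  have "(\<integral>z. overlap \<gamma> \<nu>0 \<nu>1 \<xi> \<eta> t z \<partial>square_measure) = of_real (pi\<^sup>2) *
    ((\<Sum>p\<in>site_box t. (cmod (amp0 \<gamma> \<nu>0 \<nu>1 t p))\<^sup>2 *\<^sub>R cis (\<xi> / real t * fst p + \<eta> / real t * snd p))
    + (\<Sum>p\<in>site_box t. (cmod (amp1 \<gamma> \<nu>0 \<nu>1 t p))\<^sup>2 *\<^sub>R cis (\<xi> / real t * fst p + \<eta> / real t * snd p)))"
    unfolding overlap_def Bochner_Integration.integral_add[OF i]
    unfolding famp0_def famp1_def parseval_shifted[OF parity_supp_amp(1)] parseval_shifted[OF parity_supp_amp(2)]
    by (simp add: distrib_left)
  then show ?thesis
    unfolding sum.distrib[symmetric] scaleR_left_distrib[symmetric]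
    by (simp add: walk_prob_def amp0_def amp1_def)
qed

text \<open>Dominated convergence passes to the limit \<open>L\<close> under the integral. Up to a
  part that is odd under reflection, \<open>L\<close> is a function of the velocity, and
  \<open>integral_vel\<close> turns its integral into one against the limit density.\<close>

lemma char_tendsto:
  fixes \<gamma> \<xi> \<eta> :: real and \<nu>0 \<nu>1 :: complex
  defines "\<kappa> \<equiv> cos (2 * \<gamma>)"
  assumes k: "\<bar>\<kappa>\<bar> < 1" and s: "sin (2 * \<gamma>) \<noteq> 0" and nu: "(cmod \<nu>0)\<^sup>2 + (cmod \<nu>1)\<^sup>2 = 1"
  shows "(\<lambda>t. \<Sum>p\<in>site_box t. walk_prob \<gamma> \<nu>0 \<nu>1 t (fst p) (snd p) *\<^sub>R cis (\<xi> * (fst p / real t) + \<eta> * (snd p / real t)))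
    \<longlonglongrightarrow> (\<integral>z. limit_density \<gamma> \<nu>0 \<nu>1 (fst z) (snd z) *\<^sub>R cis (\<xi> * fst z + \<eta> * snd z) \<partial>lborel)"
proof -
  define \<delta> where "\<delta> v = \<xi> * fst v + \<eta> * snd v" for v :: "real \<times> real"
  let ?l = "drift \<gamma> \<nu>0 \<nu>1"
  define r where "r z = - (2 * Im (\<nu>1 * cnj \<nu>0) * (sin (2 * \<gamma>) * sin (fst z) * sin (snd z) / disp_sin \<kappa> (fst z) (snd z)))" for z
  define L where "L z = of_real (cos (\<delta> (vel \<kappa> z))) - \<i> * of_real (?l (vel \<kappa> z) + r z) * of_real (sin (\<delta> (vel \<kappa> z)))" for z
  define H where "H v = ((1 - ?l v) / pi\<^sup>2) *\<^sub>R cis (\<xi> * fst v + \<eta> * snd v)" for v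
  \<comment> \<open>\<open>N\<close> collects all terms that are odd under \<open>(a, b) \<mapsto> (\<pi> - a, \<pi> - b)\<close>, in particular
    the one with \<open>r\<close>, which is not a function of the velocity.\<close>
  define N where "N z = of_real (?l (vel \<kappa> z) * cos (\<delta> (vel \<kappa> z))) - \<i> * of_real ((1 + r z) * sin (\<delta> (vel \<kappa> z)))" for z
  have \<delta>: "continuous_on UNIV \<delta>" unfolding \<delta>_def by (intro continuous_intros)
  have H: "continuous_on UNIV H" unfolding H_def by (intro continuous_intros) auto
  have [measurable]: "r \<in> borel_measurable borel"
    unfolding r_def disp_sin_def disp_cos_def borel_prod[symmetric] by measurable
  have [measurable]: "\<delta> \<in> borel_measurable borel" "?l \<in> borel_measurable borel" "H \<in> borel_measurable borel"
    by (intro borel_measurable_continuous_onI \<delta> drift_continuous H)+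
  have [measurable]: "L \<in> borel_measurable borel" "N \<in> borel_measurable borel"
    unfolding L_def N_def by measurable
  \<comment> \<open>The even part of \<open>L\<close> is cos \<delta> - \<i> l sin \<delta>, with
    \<open>l\<close> the drift. Adding the odd terms \<i> sin \<delta> - l cos \<delta> completes it
    to (1 - l) \<open>cis\<close> \<delta>; \<open>N\<close> takes them away again.\<close>
  have L_eq: "L z = of_real (pi\<^sup>2) * H (vel \<kappa> z) + N z" for z
  proof -
    have "of_real (pi\<^sup>2) * H v = (1 - ?l v) *\<^sub>R cis (\<delta> v)" for v
      by (simp add: H_def \<delta>_def scaleR_conv_of_real)
    then show ?thesis by (simp add: complex_eq_iff L_def N_def algebra_simps)
  qed
  have N0: "(\<integral>z. N z \<partial>square_measure) = 0"
  proof (rule integral_square_odd)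
    have "r ((pi, pi) - z) = r z" for z
      by (simp add: r_def disp_sin_def disp_cos_def algebra_simps)
    moreover have "\<delta> (- v) = - \<delta> v" for v by (simp add: \<delta>_def)
    ultimately show "N ((pi, pi) - z) = - N z" for z
      unfolding N_def vel_reflect drift_uminus by simp
  qed simp
  have m: "((cmod \<nu>0)\<^sup>2 - (cmod \<nu>1)\<^sup>2) * vel_y \<kappa> (fst z) (snd z) + 2 * Re (axis_w \<gamma> (fst z) (snd z) * \<nu>1 * cnj \<nu>0)
      = ?l (vel \<kappa> z) + r z" for z
  proof -
    let ?S = "disp_sin \<kappa> (fst z) (snd z)"
    \<comment> \<open>This combination eliminates the \<open>cos a * sin b\<close> terms and leaves
      a multiple of the real part of \<open>axis_w\<close>; the imaginary part produces
      \<open>r\<close>.\<close>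
    have "vel_x \<kappa> (fst z) (snd z) - \<kappa> * vel_y \<kappa> (fst z) (snd z) = (1 - \<kappa>\<^sup>2) * sin (fst z) * cos (snd z) / ?S"
      by (simp add: vel_x_def vel_y_def power2_eq_square algebra_simps diff_divide_distrib[symmetric])
    also have "1 - \<kappa>\<^sup>2 = sin (2 * \<gamma>) * sin (2 * \<gamma>)"
      by (simp add: \<kappa>_def sin_squared_eq flip: power2_eq_square)
    finally have re: "Re (axis_w \<gamma> (fst z) (snd z)) = (vel_x \<kappa> (fst z) (snd z) - \<kappa> * vel_y \<kappa> (fst z) (snd z)) / sin (2 * \<gamma>)"
      using s by (simp add: axis_w_def \<kappa>_def)
    have im: "Im (axis_w \<gamma> (fst z) (snd z)) = sin (2 * \<gamma>) * sin (fst z) * sin (snd z) / ?S"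
      by (simp add: axis_w_def \<kappa>_def)
    have "2 * Re (axis_w \<gamma> (fst z) (snd z) * \<nu>1 * cnj \<nu>0)
        = 2 * Re (\<nu>1 * cnj \<nu>0) * Re (axis_w \<gamma> (fst z) (snd z)) - 2 * Im (\<nu>1 * cnj \<nu>0) * Im (axis_w \<gamma> (fst z) (snd z))"
      by (simp add: algebra_simps)
    then show ?thesis unfolding re im by (simp add: drift_def r_def vel_def \<kappa>_def)
  qed
  have lim: "(\<lambda>t. overlap \<gamma> \<nu>0 \<nu>1 \<xi> \<eta> t z) \<longlonglongrightarrow> L z" if "z \<in> {0<..<pi} \<times> {0<..<pi}" for z
  proof -
    have a: "sin (fst z) \<noteq> 0" using that sin_gt_zero[of "fst z"] by (auto simp: mem_Times_iff)
    show ?thesis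
      using famp_overlap_tendsto[OF k[unfolded \<kappa>_def] a nu, of \<xi> "snd z" \<eta>]
      unfolding overlap_def L_def \<delta>_def \<kappa>_def[symmetric] m by (simp add: vel_def)
  qed
  have dom: "norm (overlap \<gamma> \<nu>0 \<nu>1 \<xi> \<eta> t z) \<le> 2" for t z
  proof -
    have "norm (overlap \<gamma> \<nu>0 \<nu>1 \<xi> \<eta> t z) \<le> 1 + 1" unfolding overlap_def
      by (intro norm_triangle_mono) (auto simp: norm_mult intro!: mult_le_one norm_famp_le_one nu)
    then show ?thesis by simp
  qed
  have const: "integrable square_measure (\<lambda>z. 2 :: real)"
    by (rule integrable_square_measure_bounded[where C = 2]) simp_all
  have meas: "L \<in> borel_measurable square_measure" "overlap \<gamma> \<nu>0 \<nu>1 \<xi> \<eta> t \<in> borel_measurable square_measure" for t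
    by (intro measurable_square_measure; simp)+
  have AElim: "AE z in square_measure. (\<lambda>t. overlap \<gamma> \<nu>0 \<nu>1 \<xi> \<eta> t z) \<longlonglongrightarrow> L z"
    by (intro AE_I2 lim) simp
  have AEdom: "AE z in square_measure. norm (overlap \<gamma> \<nu>0 \<nu>1 \<xi> \<eta> t z) \<le> 2" for t
    by (intro AE_I2 dom)
  have intL: "integrable square_measure L"
    by (rule integrable_dominated_convergence[OF meas const AElim AEdom])
  have conv: "(\<lambda>t. \<integral>z. overlap \<gamma> \<nu>0 \<nu>1 \<xi> \<eta> t z \<partial>square_measure) \<longlonglongrightarrow> (\<integral>z. L z \<partial>square_measure)"
    by (rule integral_dominated_convergence[OF meas const AElim AEdom])
  have intH: "integrable square_measure (\<lambda>z. of_real (pi\<^sup>2) * H (vel \<kappa> z))"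
    by (intro integrable_mult_right integrable_continuous_vel k H)
  have intN: "integrable square_measure N"
    using Bochner_Integration.integrable_diff[OF intL intH] by (simp add: L_eq)
  have "(\<integral>z. L z \<partial>square_measure) = of_real (pi\<^sup>2) * (\<integral>z. H (vel \<kappa> z) \<partial>square_measure)"
    unfolding L_eq Bochner_Integration.integral_add[OF intH intN] N0 by simp
  also have "(\<integral>z. H (vel \<kappa> z) \<partial>square_measure) = (\<integral>z. base_density \<kappa> z *\<^sub>R H z \<partial>lborel)"
    by (rule integral_vel(1)[OF k]) simp
  also have "\<dots> = (\<integral>z. limit_density \<gamma> \<nu>0 \<nu>1 (fst z) (snd z) *\<^sub>R cis (\<xi> * fst z + \<eta> * snd z) \<partial>lborel)"
    unfolding limit_density_eq[OF s] H_def \<kappa>_def by simp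
  finally have L_int: "(\<integral>z. L z \<partial>square_measure) = of_real (pi\<^sup>2) *
    (\<integral>z. limit_density \<gamma> \<nu>0 \<nu>1 (fst z) (snd z) *\<^sub>R cis (\<xi> * fst z + \<eta> * snd z) \<partial>lborel)" .
  have "(\<lambda>t. of_real (1 / pi\<^sup>2) * (\<integral>z. overlap \<gamma> \<nu>0 \<nu>1 \<xi> \<eta> t z \<partial>square_measure))
     \<longlonglongrightarrow> of_real (1 / pi\<^sup>2) * (of_real (pi\<^sup>2) * (\<integral>z. limit_density \<gamma> \<nu>0 \<nu>1 (fst z) (snd z) *\<^sub>R cis (\<xi> * fst z + \<eta> * snd z) \<partial>lborel))"
    using tendsto_mult_left[OF conv, of "of_real (1 / pi\<^sup>2)"] unfolding L_int .
  moreover have "of_real (1 / pi\<^sup>2) * (of_real (pi\<^sup>2) * w) = w" for w :: complex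
    by (simp flip: mult.assoc of_real_mult)
  ultimately show ?thesis unfolding char_eq_overlap[OF nu] by simp
qed

text \<open>The excluded angles are exactly the zeros of sin (2 \<gamma>) in (0, 2 \<pi>). There
  \<kappa> would be 1 or -1 and the spherical triangle would degenerate.\<close>

lemma sin_double_neq_zero:
  assumes "0 < \<gamma>" "\<gamma> < 2 * pi" "\<gamma> \<noteq> pi / 2" "\<gamma> \<noteq> pi" "\<gamma> \<noteq> 3 * pi / 2"
  shows "sin (2 * \<gamma>) \<noteq> 0"
proof
  assume "sin (2 * \<gamma>) = 0"
  then obtain i :: int where i: "2 * \<gamma> = of_int i * pi" unfolding sin_zero_iff_int2 by blast
  then have "0 < of_int i * pi" "of_int i * pi < 4 * pi" using assms(1,2) by linarith+
  then have "0 < real_of_int i" "real_of_int i < 4"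
    using mult_less_cancel_right_pos[OF pi_gt_zero] zero_less_mult_pos2[OF _ pi_gt_zero] by blast+
  then have "0 < i" "i < 4" by linarith+
  then have "i = 1 \<or> i = 2 \<or> i = 3" by auto
  then show False using i assms by auto
qed

theorem theorem3:
  fixes \<gamma> :: real and \<nu>0 \<nu>1 :: complex and x y :: real
  assumes "0 < \<gamma>" and "\<gamma> < 2 * pi"
    and "\<gamma> \<noteq> pi / 2" and "\<gamma> \<noteq> pi" and "\<gamma> \<noteq> 3 * pi / 2"
    and "(cmod \<nu>0)\<^sup>2 + (cmod \<nu>1)\<^sup>2 = 1"
  shows "(\<lambda>t. walk_cdf \<gamma> \<nu>0 \<nu>1 t x y) \<longlonglongrightarrow>
           (LINT u:{..x}|lborel. (LINT v:{..y}|lborel. limit_density \<gamma> \<nu>0 \<nu>1 u v))"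
proof -
  let ?\<kappa> = "cos (2 * \<gamma>)"
  let ?f = "\<lambda>z. limit_density \<gamma> \<nu>0 \<nu>1 (fst z) (snd z)"
  let ?P = "\<lambda>t p. walk_prob \<gamma> \<nu>0 \<nu>1 t (fst p) (snd p)"
  let ?X = "\<lambda>t p. (real_of_int (fst p) / real t, real_of_int (snd p) / real t)"
  have s: "sin (2 * \<gamma>) \<noteq> 0" using sin_double_neq_zero[OF assms(1-5)] .
  have k: "\<bar>?\<kappa>\<bar> < 1"
  proof -
    have "0 < (sin (2 * \<gamma>))\<^sup>2" using s by simp
    then have "?\<kappa>\<^sup>2 < 1" unfolding sin_squared_eq by simp
    then show ?thesis by (simp add: abs_square_less_1)
  qed
  have dens: "continuous_on UNIV (\<lambda>z. (1 - drift \<gamma> \<nu>0 \<nu>1 z) / pi\<^sup>2)"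
    by (intro continuous_intros) auto
  interpret char_convergence site_box ?P ?X ?f
  proof
    show "0 \<le> ?P t p" for t p by (simp add: walk_prob_def)
    show "?X t p \<in> cbox (-1, -1) (1, 1)" if "p \<in> site_box t" for t p
      \<comment> \<open>At \<open>t = 0\<close> both quotients are 0 by the convention for
        division.\<close>
      using that by (cases "t = 0") (auto simp: site_box_def cbox_Pair_eq divide_simps)
    \<comment> \<open>\<open>base_density\<close> is unbounded where the ellipse touches the square
      [-1, 1] x [-1, 1], so integrability is read off on the momentum side, where the integrand is
      bounded.\<close>
    show "integrable lborel ?f"
      using integrable_continuous_vel[OF k dens]
        integral_vel(2)[OF k borel_measurable_continuous_onI[OF dens]]
      unfolding limit_density_eq[OF s] by simp
    show "z \<in> cbox (-1, -1) (1, 1)" if "?f z \<noteq> 0" for z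
    proof -
      have "z \<in> ellipse ?\<kappa>"
        using that unfolding limit_density_eq[OF s] by (auto simp: base_density_def indicator_def split: if_splits)
      from ellipse_bounds[OF k this] show ?thesis by (cases z) (auto simp: cbox_Pair_eq)
    qed
    show "(\<lambda>t. \<Sum>p\<in>site_box t. ?P t p *\<^sub>R cis (\<xi> * fst (?X t p) + \<eta> * snd (?X t p)))
        \<longlonglongrightarrow> (\<integral>z. ?f z *\<^sub>R cis (\<xi> * fst z + \<eta> * snd z) \<partial>lborel)" for \<xi> \<eta>
      using char_tendsto[OF k s assms(6), of \<xi> \<eta>] by simp
  qed
  have i: "integrable (lborel \<Otimes>\<^sub>M lborel) (\<lambda>z. ?f z * indicator ({..x} \<times> {..y}) z)"
    unfolding lborel_prod
  proof (rule integrable_real_mult_indicator)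
    have "{..x} \<times> {..y} \<in> sets (borel :: (real \<times> real) measure)"
      by (intro borel_closed closed_Times closed_atMost)
    then show "{..x} \<times> {..y} \<in> sets lborel" by simp
  qed (rule f_int)
  have "(\<integral>z. ?f z * indicator ({..x} \<times> {..y}) z \<partial>lborel)
      = (\<integral>u. \<integral>v. limit_density \<gamma> \<nu>0 \<nu>1 u v * (indicator {..x} u * indicator {..y} v) \<partial>lborel \<partial>lborel)"
    using lborel_pair.integral_fst'[OF i] unfolding lborel_prod by (simp add: indicator_times)
  also have "\<dots> = (LINT u:{..x}|lborel. (LINT v:{..y}|lborel. limit_density \<gamma> \<nu>0 \<nu>1 u v))"
    unfolding set_lebesgue_integral_def
    by (intro Bochner_Integration.integral_cong refl) (simp add: indicator_def mult.commute)
  finally show ?thesis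
    using cdf_convergence[of x y] unfolding walk_cdf_def site_box_def by simp
qed

end
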